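(* Let $k$ be a field of characteristic $p>0$ and let $l,m\ge1$, $t\ge2$ be integers with $mt\ge3$, $p\nmid t$ and $p\nmid mt-1$. In $k[x_1,x_2,x_3]$ put $f:=x_1x_3-x_2^t$, $r:=f^lx_2+x_1^m$, $g:=x_1^{-1}(f^{lt+1}+r^t)$; let $\epsilon$ be the $\mathbf{G}_a$-action described in the context, and let $h\in k[f,g]$ with $h^{p-1}\in f^{l+1}g^2k[f,g]\setminus\{0\}$. Put $q:=r^p-(f^lgh)^{p-1}r$ and let $\psi:C[r^p]\to C[r]$ be the $C$-algebra homomorphism $u(r^p)\mapsto u(q)$. Then: (i) $k[x_1,x_2,x_3]^{\epsilon_h}=\psi(k[x_1^p,x_2^p,x_3^p,f,g])=k[\psi(x_1^p),\psi(x_2^p),\psi(x_3^p),f,g]$; (ii) the $k$-algebra $k[x_1,x_2,x_3]^{\epsilon_h}$ is isomorphic to $k[x_1,x_2,x_3,y,z]/(y^p-f,\,z^p-g)$ (polynomial ring in five variables modulo this ideal), and is not isomorphic to $k[x_1,x_2,x_3]$.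
   Context: The element $g$ is a polynomial; $f,g,r$ are algebraically independent over $k$, and with $C:=k[f^{\pm1},g^{\pm1}]\subset k(x_1,x_2,x_3)$ one has $k[x_1,x_2,x_3]\subset C[r]$, a polynomial ring in $r$ over $C$. Let $\tilde\epsilon:C[r]\to C[r][T]$ be the $C$-algebra homomorphism $u(r)\mapsto u(r+f^lgT)$; it maps $k[x_1,x_2,x_3]$ into $k[x_1,x_2,x_3][T]$, and $\epsilon$ is its restriction. For $b\in k[x_1,x_2,x_3]$, $\epsilon_h(b):=\epsilon(b)|_{T=h}$ defines a $k$-automorphism $\epsilon_h$ of $k[x_1,x_2,x_3]$, and $k[x_1,x_2,x_3]^{\epsilon_h}:=\{b\mid\epsilon_h(b)=b\}$. One has $x_1^p,x_2^p,x_3^p\in C[r^p]$ and $f,g\in C$, so $\psi$ is defined on $k[x_1^p,x_2^p,x_3^p,f,g]$. *)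

theory Defs
  imports "HOL-Computational_Algebra.Polynomial" "HOL-Computational_Algebra.Fraction_Field"
begin

text \<open>The polynomial ring k[x1,x2,x3] is modelled as the type k poly poly poly:
  x3 is the outermost variable, x2 the middle one, x1 the innermost one.
  Its fraction field k(x1,x2,x3) is the type (k poly poly poly) fract.\<close>

type_synonym 'k R3 = "'k poly poly poly"
type_synonym 'k K3 = "'k poly poly poly fract"

definition X1 :: "'k::field R3" where "X1 = [:[:[:0, 1:]:]:]"
definition X2 :: "'k::field R3" where "X2 = [:[:0, 1:]:]"
definition X3 :: "'k::field R3" where "X3 = [:0, 1:]"
definition cR :: "'k::field \<Rightarrow> 'k R3" where "cR c = [:[:[:c:]:]:]"

definition emb :: "'k::field R3 \<Rightarrow> 'k K3" where "emb a = Fract a 1"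
definition cK :: "'k::field \<Rightarrow> 'k K3" where "cK c = emb (cR c)"

inductive_set kalg :: "('k \<Rightarrow> 'b::comm_ring_1) \<Rightarrow> 'b set \<Rightarrow> 'b set" for iota S where
  const: "iota c \<in> kalg iota S"
| gen: "s \<in> S \<Longrightarrow> s \<in> kalg iota S"
| add: "a \<in> kalg iota S \<Longrightarrow> b \<in> kalg iota S \<Longrightarrow> a + b \<in> kalg iota S"
| mult: "a \<in> kalg iota S \<Longrightarrow> b \<in> kalg iota S \<Longrightarrow> a * b \<in> kalg iota S"

definition fpol :: "nat \<Rightarrow> 'k::field R3" where "fpol t = X1 * X3 - X2 ^ t"
definition rpol :: "nat \<Rightarrow> nat \<Rightarrow> nat \<Rightarrow> 'k::field R3"
  where "rpol l m t = fpol t ^ l * X2 + X1 ^ m"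
definition gpol :: "nat \<Rightarrow> nat \<Rightarrow> nat \<Rightarrow> 'k::field R3"
  where "gpol l m t = (fpol t ^ (l * t + 1) + rpol l m t ^ t) div X1"

definition Cring :: "'k::field K3 \<Rightarrow> 'k K3 \<Rightarrow> 'k K3 set" where
  "Cring f g = {a * inverse (f ^ i * g ^ j) | a i j. a \<in> kalg cK {f, g}}"

definition polys_over :: "'a::zero set \<Rightarrow> 'a poly set" where
  "polys_over A = {u. \<forall>i. coeff u i \<in> A}"

definition eps_tilde :: "nat \<Rightarrow> nat \<Rightarrow> nat \<Rightarrow> 'k::field K3 \<Rightarrow> 'k K3 poly" where
  "eps_tilde l m t b = (THE e. \<exists>u \<in> polys_over (Cring (emb (fpol t)) (emb (gpol l m t))).
       b = poly u (emb (rpol l m t)) \<and>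
       e = poly (map_poly (\<lambda>c. [:c:]) u)
                [:emb (rpol l m t), emb (fpol t) ^ l * emb (gpol l m t):])"

definition eps_h :: "nat \<Rightarrow> nat \<Rightarrow> nat \<Rightarrow> 'k::field R3 \<Rightarrow> 'k R3 \<Rightarrow> 'k K3" where
  "eps_h l m t h b = poly (eps_tilde l m t (emb b)) (emb h)"

definition invariants :: "nat \<Rightarrow> nat \<Rightarrow> nat \<Rightarrow> 'k::field R3 \<Rightarrow> 'k R3 set" where
  "invariants l m t h = {b. eps_h l m t h b = emb b}"

definition qpol :: "nat \<Rightarrow> nat \<Rightarrow> nat \<Rightarrow> nat \<Rightarrow> 'k::field R3 \<Rightarrow> 'k R3" where
  "qpol p l m t h = rpol l m t ^ p - (fpol t ^ l * gpol l m t * h) ^ (p - 1) * rpol l m t"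

definition psi :: "nat \<Rightarrow> nat \<Rightarrow> nat \<Rightarrow> nat \<Rightarrow> 'k::field R3 \<Rightarrow> 'k K3 \<Rightarrow> 'k K3" where
  "psi p l m t h b = (THE c. \<exists>u \<in> polys_over (Cring (emb (fpol t)) (emb (gpol l m t))).
       b = poly u (emb (rpol l m t) ^ p) \<and> c = poly u (emb (qpol p l m t h)))"

definition kalg_hom :: "('k \<Rightarrow> 'a::comm_ring_1) \<Rightarrow> ('k \<Rightarrow> 'b::comm_ring_1) \<Rightarrow> ('a \<Rightarrow> 'b) \<Rightarrow> bool" where
  "kalg_hom ia ib phi \<longleftrightarrow> (\<forall>c. phi (ia c) = ib c) \<and>
     (\<forall>x y. phi (x + y) = phi x + phi y) \<and> (\<forall>x y. phi (x * y) = phi x * phi y)"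

text \<open>k[x1,x2,x3,y,z] as the type k poly poly poly poly poly (z outermost, then y,
  then x3, x2, x1).\<close>
type_synonym 'k R5 = "'k poly poly poly poly poly"

definition Y5 :: "'k::field R5" where "Y5 = [:[:0, 1:]:]"
definition Z5 :: "'k::field R5" where "Z5 = [:0, 1:]"
definition incl35 :: "'k::field R3 \<Rightarrow> 'k R5" where "incl35 a = [:[:a:]:]"
definition cR5 :: "'k::field \<Rightarrow> 'k R5" where "cR5 c = incl35 (cR c)"

end

theory Submission
  imports Defs "HOL-Computational_Algebra.Polynomial_Factorial"
    "HOL-Computational_Algebra.Formal_Laurent_Series"
begin

text \<open>Write \<open>A = k[x\<^sub>1,x\<^sub>2,x\<^sub>3]\<close> and \<open>q\<close> for \<open>r\<^sup>p - (f\<^sup>lgh)\<^sup>p\<^sup>-\<^sup>1r\<close>. Substituting \<open>r + f\<^sup>lgh\<close> for \<open>r\<close> fixes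
  exactly \<open>C[q]\<close> inside \<open>C[r]\<close> (Artin-Schreier), so the invariant ring is the intersection of
  \<open>A\<close> with \<open>C[q]\<close>. The divisibility of \<open>h\<^sup>p\<^sup>-\<^sup>1\<close> makes the images \<open>x'\<^sub>i\<close> of \<open>x\<^sub>i\<^sup>p\<close> under \<open>\<psi>\<close> lie in \<open>A\<close> and
  be congruent to \<open>x\<^sub>i\<^sup>p\<close> modulo \<open>fg\<close> (for \<open>i = 3\<close> after cancelling \<open>x\<^sub>1\<^sup>p\<close>).
  Let \<open>B = k[x'\<^sub>1,x'\<^sub>2,x'\<^sub>3,f,g]\<close>. Inverting \<open>f\<close> and \<open>g\<close> identifies \<open>B\<close> with \<open>C[q]\<close>, so it suffices that
  \<open>fA \<inter> B = fB\<close> and \<open>gA \<inter> B = gB\<close>. Both are read off parametrisations of the surfaces \<open>f = 0\<close>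
  and \<open>g = 0\<close> over a Laurent series ring in \<open>\<tau>\<close>: on \<open>f = 0\<close> the function \<open>g\<close> becomes \<open>\<tau>\<^sup>m\<^sup>t\<^sup>-\<^sup>1\<close>, on \<open>g = 0\<close>
  the function \<open>f\<close> becomes \<open>-\<tau>\<^sup>t\<close>, and polynomials in the \<open>x'\<^sub>i\<close> only involve exponents of \<open>\<tau>\<close>
  divisible by \<open>p\<close>. The same divisibility statement yields the presentation of \<open>B\<close>, whose relations have no
  linear terms at the origin; there the tangent space of \<open>B\<close> has dimension 5, but that of
  \<open>A\<close> has dimension 3 at every rational point.\<close>

section \<open>Ring homomorphisms on iterated polynomial rings\<close>

locale rhom =
  fixes f :: "'a::comm_ring_1 \<Rightarrow> 'b::comm_ring_1"
  assumes one [simp]: "f 1 = 1"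
    and add [simp]: "f (x + y) = f x + f y"
    and mult [simp]: "f (x * y) = f x * f y"
begin

lemma zero [simp]: "f 0 = 0"
  using add[of 0 0] by simp

lemma minus [simp]: "f (- x) = - f x"
  using add[of x "-x"] by (simp add: eq_neg_iff_add_eq_0 add.commute)

lemma diff [simp]: "f (x - y) = f x - f y"
  using add[of x "-y"] by simp

lemma power [simp]: "f (x ^ n) = f x ^ n"
  by (induction n) auto

lemma sum [simp]: "f (sum g A) = (\<Sum>x\<in>A. f (g x))"
  by (induction A rule: infinite_finite_induct) auto

lemma dvd: "x dvd y \<Longrightarrow> f x dvd f y"
  by (auto simp: dvd_def)

lemmas hom = one zero add minus diff mult power sum

end

lemma rhom_comp: "rhom f \<Longrightarrow> rhom g \<Longrightarrow> rhom (\<lambda>x. f (g x))"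
  by (simp add: rhom_def)

text \<open>The universal property of polynomial rings: \<open>f\<close> acts on the coefficients
  and \<open>a\<close> is the image of the variable. Iterating it yields \<open>ev2\<close>,
  \<open>ev3\<close> and \<open>ev5\<close>.\<close>

definition ext :: "('a::comm_ring_1 \<Rightarrow> 'b::comm_ring_1) \<Rightarrow> 'b \<Rightarrow> 'a poly \<Rightarrow> 'b" where
  "ext f a P = poly (map_poly f P) a"

lemma ext_pCons: "rhom f \<Longrightarrow> ext f a (pCons c P) = f c + a * ext f a P"
  by (simp add: ext_def map_poly_pCons rhom.zero)

lemma ext_0 [simp]: "ext f a 0 = 0"
  by (simp add: ext_def)

lemma ext_const: "rhom f \<Longrightarrow> ext f a [:c:] = f c"
  by (simp add: ext_pCons)

lemma ext_X: "rhom f \<Longrightarrow> ext f a [:0, 1:] = a"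
  by (simp add: ext_pCons rhom.zero rhom.one)

lemma rhom_ext:
  assumes "rhom f" shows "rhom (ext f a)"
proof -
  interpret rhom f by fact
  have A: "map_poly f (P + Q) = map_poly f P + map_poly f Q" for P Q
    by (intro poly_eqI) (simp add: coeff_map_poly)
  have M: "map_poly f (P * Q) = map_poly f P * map_poly f Q" for P Q
    by (intro poly_eqI) (simp add: coeff_map_poly coeff_mult)
  show ?thesis
    by unfold_locales (simp_all add: ext_def A M)
qed

lemma poly_hom_eqI:
  assumes "rhom f" "rhom g" "\<And>c. f [:c:] = g [:c:]" "f [:0, 1:] = g [:0, 1:]"
  shows "f P = g P"
proof (induction P)
  case 0
  show ?case using assms(3)[of 0] by simp
next
  case (pCons a P)
  have "pCons a P = [:a:] + [:0, 1:] * P" by simp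
  then show ?case
    by (simp only: rhom.add[OF assms(1)] rhom.add[OF assms(2)] rhom.mult[OF assms(1)]
        rhom.mult[OF assms(2)] assms(3,4) pCons.IH)
qed

lemma rhom_pC: "rhom (\<lambda>c::'a::comm_ring_1. [:c:])"
  by unfold_locales (simp_all add: one_pCons)

lemma rhom_poly: "rhom (\<lambda>P::'a::comm_ring_1 poly. poly P a)"
  by unfold_locales simp_all

definition ev3 :: "('k::field \<Rightarrow> 'b::comm_ring_1) \<Rightarrow> 'b \<Rightarrow> 'b \<Rightarrow> 'b \<Rightarrow> 'k R3 \<Rightarrow> 'b" where
  "ev3 i a b c = ext (ext (ext i a) b) c"

lemma rhom_ev3: "rhom i \<Longrightarrow> rhom (ev3 i a b c)"
  by (simp add: ev3_def rhom_ext)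

lemma ev3_simps:
  assumes "rhom i"
  shows "ev3 i a b c X1 = a" "ev3 i a b c X2 = b" "ev3 i a b c X3 = c" "ev3 i a b c (cR k) = i k"
  using assms by (simp_all add: ev3_def X1_def X2_def X3_def cR_def ext_const ext_X rhom_ext)

lemma R3_hom_eqI:
  assumes f: "rhom f" and g: "rhom g" and "\<And>c. f (cR c) = g (cR c)"
    and "f X1 = g X1" "f X2 = g X2" "f X3 = g X3"
  shows "f P = g (P :: 'k::field R3)"
proof -
  have 1: "f [:[:c:]:] = g [:[:c:]:]" for c
  proof (rule poly_hom_eqI[of "\<lambda>c. f [:[:c:]:]" "\<lambda>c. g [:[:c:]:]"])
    show "rhom (\<lambda>c. f [:[:c:]:])" "rhom (\<lambda>c. g [:[:c:]:])"
      using rhom_comp[OF f rhom_comp[OF rhom_pC rhom_pC]] rhom_comp[OF g rhom_comp[OF rhom_pC rhom_pC]]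
      by simp_all
  qed (use assms(3,4) in \<open>simp_all add: X1_def cR_def\<close>)
  have 2: "f [:c:] = g [:c:]" for c
    by (rule poly_hom_eqI[of "\<lambda>c. f [:c:]" "\<lambda>c. g [:c:]", OF rhom_comp[OF f rhom_pC] rhom_comp[OF g rhom_pC]])
      (use 1 assms(5) in \<open>simp_all add: X2_def\<close>)
  show ?thesis
    by (rule poly_hom_eqI[OF f g]) (use 2 assms(6) in \<open>simp_all add: X3_def\<close>)
qed

lemma rhom_cR: "rhom cR"
  by unfold_locales (simp_all add: cR_def one_pCons)

lemma rhom_emb: "rhom emb"
  by unfold_locales (simp_all add: emb_def One_fract_def)

lemma emb_eq_iff [simp]: "emb a = emb b \<longleftrightarrow> a = b"
  by (simp add: emb_def eq_fract)

lemma rhom_cK: "rhom cK"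
  unfolding cK_def[abs_def] by (rule rhom_comp[OF rhom_emb rhom_cR])

lemma emb_eq_0_iff [simp]: "emb a = 0 \<longleftrightarrow> a = 0"
  using emb_eq_iff[of a 0] by (simp add: rhom.zero[OF rhom_emb])

lemma idom_CHAR_eqI:
  assumes "prime p" "of_nat p = (0::'a::idom)"
  shows "CHAR('a) = p"
  using assms by (metis CHAR_not_1 One_nat_def of_nat_eq_0_iff_char_dvd prime_nat_iff)

section \<open>Generated subalgebras, induction over polynomial rings, division by a
  binomial\<close>

lemma kalg_least:
  assumes "\<And>c. i c \<in> A" "S \<subseteq> A" "\<And>a b. a \<in> A \<Longrightarrow> b \<in> A \<Longrightarrow> a + b \<in> A"
    "\<And>a b. a \<in> A \<Longrightarrow> b \<in> A \<Longrightarrow> a * b \<in> A"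
  shows "kalg i S \<subseteq> A"
proof
  show "x \<in> A" if "x \<in> kalg i S" for x
    using that by induction (use assms in auto)
qed

lemma kalg_image:
  assumes "rhom f" "\<And>c. f (i c) = j c"
  shows "kalg j (f ` S) = f ` kalg i S"
proof
  show "kalg j (f ` S) \<subseteq> f ` kalg i S"
  proof (rule kalg_least)
    show "j c \<in> f ` kalg i S" for c using assms(2) kalg.const by (metis imageI)
    show "f ` S \<subseteq> f ` kalg i S" by (auto intro: kalg.gen)
    fix a b assume "a \<in> f ` kalg i S" "b \<in> f ` kalg i S"
    then show "a + b \<in> f ` kalg i S" "a * b \<in> f ` kalg i S"
      by (auto simp: rhom.add[OF assms(1), symmetric] rhom.mult[OF assms(1), symmetric] intro: kalg.intros)
  qed
  have "f x \<in> kalg j (f ` S)" if "x \<in> kalg i S" for x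
    using that
    by induction (auto simp: assms(2) rhom.add[OF assms(1)] rhom.mult[OF assms(1)] intro: kalg.intros)
  then show "f ` kalg i S \<subseteq> kalg j (f ` S)" by auto
qed

lemma poly_ring_induct:
  assumes "\<And>c. P [:c:]" "P [:0, 1:]" "\<And>a b. P a \<Longrightarrow> P b \<Longrightarrow> P (a + b)"
    "\<And>a b. P a \<Longrightarrow> P b \<Longrightarrow> P (a * b)"
  shows "P (x :: 'a::comm_ring_1 poly)"
proof (induction x)
  case 0
  show ?case using assms(1)[of 0] by simp
next
  case (pCons a x)
  have "pCons a x = [:a:] + [:0, 1:] * x" by simp
  then show ?case using assms(3)[OF assms(1) assms(4)[OF assms(2) pCons.IH]] by simp
qed

lemma R3_induct [case_names const X1 X2 X3 add mult]:
  assumes "\<And>c. P (cR c)" "P X1" "P X2" "P X3" "\<And>a b. P a \<Longrightarrow> P b \<Longrightarrow> P (a + b)"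
    "\<And>a b. P a \<Longrightarrow> P b \<Longrightarrow> P (a * b)"
  shows "P (x :: 'k::field R3)"
proof -
  have 1: "P [:[:c:]:]" for c
  proof (induction c rule: poly_ring_induct)
    case (3 a b) then show ?case using assms(5)[of "[:[:a:]:]" "[:[:b:]:]"] by simp
  next
    case (4 a b) then show ?case using assms(6)[of "[:[:a:]:]" "[:[:b:]:]"] by simp
  qed (use assms in \<open>auto simp: cR_def X1_def\<close>)
  have 2: "P [:c:]" for c
  proof (induction c rule: poly_ring_induct)
    case (3 a b) then show ?case using assms(5)[of "[:a:]" "[:b:]"] by (simp add: mult.commute)
  next
    case (4 a b) then show ?case using assms(6)[of "[:a:]" "[:b:]"] by (simp add: mult.commute)
  qed (use 1 assms in \<open>auto simp: X2_def\<close>)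
  show ?thesis
    by (induction x rule: poly_ring_induct) (use 2 assms in \<open>auto simp: X3_def\<close>)
qed

text \<open>Division by the monic X^n - c works over any commutative ring. It reduces powers of
  \<open>r\<close> modulo \<open>X1 * g\<close> and normalises elements of the five-variable ring
  modulo y^p - f and z^p - g.\<close>

lemma monic_binomial_reduce:
  fixes P :: "'a::comm_ring_1 poly"
  assumes "n > 0"
  shows "\<exists>Q b. P = Q * ([:0, 1:] ^ n - [:c:]) + (\<Sum>j<n. [:b j:] * [:0, 1:] ^ j)"
proof (induction P)
  case 0
  show ?case by (rule exI[of _ 0], rule exI[of _ "\<lambda>_. 0"]) simp
next
  case (pCons a P)
  then obtain Q b where P: "P = Q * ([:0, 1:] ^ n - [:c:]) + (\<Sum>j<n. [:b j:] * [:0, 1:] ^ j)" by blast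
  obtain k where n: "n = Suc k" using assms by (cases n) auto
  define X where "X = [:0, 1 :: 'a:]"
  \<comment> \<open>Multiplication by \<open>X\<close> shifts the remainder by one place; its top
    coefficient \<open>b k\<close> wraps around to the constant term with a factor
    \<open>c\<close>.\<close>
  define b' where "b' j = (case j of 0 \<Rightarrow> a + b k * c | Suc i \<Rightarrow> b i)" for j
  have "pCons a P = [:a:] + X * P" by (simp add: X_def)
  also have "\<dots> = [:a:] + X * Q * (X ^ n - [:c:]) + (\<Sum>j<k. [:b j:] * X ^ Suc j) + [:b k:] * X ^ n"
    unfolding P X_def[symmetric] by (simp add: n algebra_simps sum_distrib_left)
  also have "\<dots> = (X * Q + [:b k:]) * (X ^ n - [:c:]) + ([:a + b k * c:] + (\<Sum>j<k. [:b j:] * X ^ Suc j))"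
    by (simp add: algebra_simps)
  also have "[:a + b k * c:] + (\<Sum>j<k. [:b j:] * X ^ Suc j) = (\<Sum>j<n. [:b' j:] * X ^ j)"
    unfolding n by (subst sum.lessThan_Suc_shift) (simp add: b'_def)
  finally show ?case unfolding X_def by blast
qed

section \<open>Laurent series and the substitution of p-th powers\<close>

unbundle fps_syntax

text \<open>Both surfaces are parametrised in the domain k((\<tau>))[W], encoded as polynomials over
  formal Laurent series: \<open>XT n\<close> is \<tau>^n for an integer \<open>n\<close>, and
  \<open>WT\<close> is W.\<close>

definition iT :: "'k::field \<Rightarrow> 'k fls poly" where "iT c = [:fls_const c:]"
definition XT :: "int \<Rightarrow> 'k::field fls poly" where "XT n = [:fls_X_intpow n:]"
definition WT :: "'k::field fls poly" where "WT = [:0, 1:]"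

text \<open>The substitution of \<tau>^p and W^p for \<tau> and W. Unlike Frobenius it fixes the
  constants of k, so that it can be compared with the k-linear map \<open>Phi\<close>.\<close>

definition theta :: "nat \<Rightarrow> 'k::field fls poly \<Rightarrow> 'k fls poly" where
  "theta p = ext (\<lambda>c. [:fls_compose_power c p:]) (WT ^ p)"

lemma rhom_iT: "rhom (iT :: 'k::field \<Rightarrow> _)"
  by unfold_locales (simp_all add: iT_def one_pCons fls_plus_const mult.commute)

lemma rhom_compose_power: "p > 0 \<Longrightarrow> rhom (\<lambda>c :: 'k::field fls. [:fls_compose_power c p:])"
  by unfold_locales (simp_all add: one_pCons)

lemma rhom_theta: "p > 0 \<Longrightarrow> rhom (theta p)"
  unfolding theta_def by (intro rhom_ext rhom_compose_power)

lemma XT_0 [simp]: "XT 0 = 1"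
  by (simp add: XT_def one_pCons)

lemma XT_mult: "XT a * XT b = XT (a + b)"
  by (simp add: XT_def fls_X_intpow_times_fls_X_intpow algebra_simps)

lemma XT_power: "XT a ^ n = XT (int n * a)"
  by (induction n) (simp_all add: XT_mult algebra_simps)

lemma XT_nonzero [simp]: "XT a \<noteq> 0"
  by (simp add: XT_def)

lemma WT_nonzero [simp]: "WT \<noteq> 0"
  by (simp add: WT_def)

lemma WT_power: "WT ^ n = monom 1 n"
  by (simp add: WT_def monom_altdef)

lemma theta_iT: "p > 0 \<Longrightarrow> theta p (iT c) = iT c"
  by (simp add: theta_def iT_def ext_const[OF rhom_compose_power])

lemma theta_XT: "p > 0 \<Longrightarrow> theta p (XT n) = XT n ^ p"
  by (simp add: theta_def XT_power ext_const[OF rhom_compose_power]) (simp add: XT_def ext_const[OF rhom_compose_power])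

lemma theta_WT: "p > 0 \<Longrightarrow> theta p WT = WT ^ p"
  by (simp add: theta_def ext_X[OF rhom_compose_power, of p "WT ^ p", folded WT_def])

lemma coeff_theta:
  assumes "p > 0"
  shows "coeff (theta p P) (p * d) = fls_compose_power (coeff P d) p"
proof (induction P arbitrary: d)
  case 0
  show ?case by (simp add: rhom.zero[OF rhom_theta[OF assms]])
next
  case (pCons a P)
  have "theta p (pCons a P) = [:fls_compose_power a p:] + monom 1 p * theta p P"
    by (simp add: theta_def ext_pCons[OF rhom_compose_power[OF assms]] WT_power)
  then show ?case
    using pCons.IH[of "d - 1"] assms
    by (cases d) (auto simp: coeff_monom_mult coeff_pCons split: nat.splits)
qed

text \<open>Values of \<open>theta p\<close> only involve exponents of \<tau> divisible by
  \<open>p\<close>, so the summand of index \<open>i\<close> lives in exponents congruent to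
  \<open>n * i\<close> modulo \<open>p\<close>. These classes are distinct for \<open>i < p\<close>
  because the prime \<open>p\<close> does not divide \<open>n\<close>; hence no cancellation
  occurs.\<close>

lemma theta_independent:
  fixes P :: "nat \<Rightarrow> 'k::field fls poly"
  assumes "prime p" "\<not> p dvd n" "(\<Sum>i<p. XT (int (n * i)) * theta p (P i)) = 0" "i < p"
  shows "P i = 0"
proof -
  have p: "p > 0" using assms by (simp add: prime_gt_0_nat)
  have "coeff (P i) d $$ e = 0" for d e
  proof -
    \<comment> \<open>The exponent at which the coefficient of index \<open>e\<close> of
      \<open>coeff (P i) d\<close> appears in the \<open>i\<close>-th summand.\<close>
    let ?N = "int (n * i) + int p * e"
    have "0 = coeff (\<Sum>i<p. XT (int (n * i)) * theta p (P i)) (p * d) $$ ?N"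
      using assms by simp
    also have "\<dots> = (\<Sum>j<p. fls_compose_power (coeff (P j) d) p $$ (?N - int (n * j)))"
      by (simp add: coeff_sum fls_nth_sum XT_def coeff_theta[OF p] fls_X_intpow_times_conv_shift)
    also have "\<dots> = (\<Sum>j<p. if j = i then coeff (P i) d $$ e else 0)"
    proof (rule sum.cong)
      fix j assume j: "j \<in> {..<p}"
      show "fls_compose_power (coeff (P j) d) p $$ (?N - int (n * j)) = (if j = i then coeff (P i) d $$ e else 0)"
      proof (cases "j = i")
        case True
        then show ?thesis using p by (simp add: fls_nth_compose_power)
      next
        case False
        have "\<not> int p dvd ?N - int (n * j)"
        proof
          assume "int p dvd ?N - int (n * j)"
          moreover have "?N - int (n * j) = int n * (int i - int j) + int p * e"
            by (simp add: algebra_simps)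
          ultimately have "int p dvd int n * (int i - int j)"
            by (metis dvd_add_times_triv_right_iff mult.commute)
          then have "int p dvd int i - int j"
            using assms by (simp add: prime_dvd_mult_iff)
          moreover have "\<bar>int i - int j\<bar> < int p" "int i - int j \<noteq> 0"
            using j False assms(4) by auto
          ultimately show False
            using zdvd_not_zless[of "\<bar>int i - int j\<bar>" "int p"] by simp
        qed
        then show ?thesis using False p by (simp add: fls_nth_compose_power)
      qed
    qed simp
    also have "\<dots> = coeff (P i) d $$ e"
      using assms(4) by simp
    finally show ?thesis by simp
  qed
  then show ?thesis by (intro poly_eqI fls_eqI) simp
qed

section \<open>Recovering coefficients after substitution into the Laurent series ring\<close>

lemma rhom_fls_const: "rhom (fls_const :: 'k::field \<Rightarrow> _)"
  by unfold_locales (simp_all add: fls_plus_const mult.commute)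

lemma ext_const_fls_nth:
  "ext fls_const fls_X u $$ n = (if n < 0 then 0 else coeff u (nat n))" for u :: "'k::field poly"
proof (induction u arbitrary: n)
  case 0
  then show ?case by simp
next
  case (pCons a u)
  have "nat n = Suc (nat (n - 1))" if "n > 0" using that by simp
  then show ?case
    using pCons.IH[of "n - 1"]
    by (cases "n > 0") (auto simp: ext_pCons[OF rhom_fls_const] fls_X_times_conv_shift)
qed

lemma coeff_iT: "coeff (iT a) d = (if d = 0 then fls_const a else 0)"
  by (simp add: iT_def coeff_pCons split: nat.splits)

lemma coeff_WT_mult: "coeff (WT * P) d = (if d = 0 then 0 else coeff P (d - 1))"
  by (simp add: WT_def coeff_pCons split: nat.splits)

text \<open>Monomials go to distinct monomials in \<tau> and W. In \<open>phif_kernel\<close> this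
  handles polynomials free of the third variable.\<close>

lemma ext_ext_iT_inj:
  fixes c :: "'k::field poly poly"
  assumes "ext (ext iT (XT 1)) WT c = 0"
  shows "c = 0"
proof -
  have X: "(XT 1 :: 'k fls poly) = [:fls_X:]" by (simp add: XT_def fls_X_conv_shift_1)
  have 1: "ext iT (XT 1) u = [:ext fls_const fls_X u:]" for u :: "'k poly"
  proof (induction u)
    case (pCons a u)
    then show ?case
      by (simp only: ext_pCons[OF rhom_iT] ext_pCons[OF rhom_fls_const]) (simp add: iT_def[of a] X)
  qed simp
  have "coeff (ext (ext iT (XT 1)) WT c) d = ext fls_const fls_X (coeff c d)" for d
  proof (induction c arbitrary: d)
    case 0
    then show ?case by simp
  next
    case (pCons a c)
    have "ext (ext iT (XT 1)) WT (pCons a c) = [:ext fls_const fls_X a:] + WT * ext (ext iT (XT 1)) WT c"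
      unfolding ext_pCons[OF rhom_ext[OF rhom_iT]] 1 ..
    then show ?case
      using pCons.IH[of "d - 1"]
      by (simp add: coeff_WT_mult coeff_pCons split: nat.splits)
  qed
  with assms have "ext fls_const fls_X (coeff c d) = 0" for d by (metis coeff_0)
  then have "coeff (coeff c d) n = 0" for d n
    using ext_const_fls_nth[of "coeff c d" "int n"] by simp
  then show ?thesis by (intro poly_eqI) simp
qed

lemma ext_iT_WT_coeff: "coeff (ext iT WT u) d = fls_const (coeff u d)" for u :: "'k::field poly"
proof (induction u arbitrary: d)
  case 0
  then show ?case by simp
next
  case (pCons a u)
  then show ?case
    by (auto simp: ext_pCons[OF rhom_iT] coeff_iT coeff_WT_mult coeff_pCons split: nat.splits)
qed

text \<open>The inner variable plays the role of x1, the outer one that of \<open>f\<close>, which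
  is -\<tau>^t on the surface \<open>g = 0\<close>; hence the sign and the restriction to
  nonnegative multiples of \<open>t\<close>.\<close>

lemma coeff_ext_ext_iT:
  fixes c :: "'k::field poly poly"
  assumes "t > 0"
  shows "coeff (ext (ext iT WT) (- XT (int t)) c) d $$ e =
    (if int t dvd e \<and> e \<ge> 0 then (- 1) ^ nat (e div int t) * coeff (coeff c (nat (e div int t))) d else 0)"
proof (induction c arbitrary: e)
  case 0
  then show ?case by simp
next
  case (pCons a c)
  have "coeff (ext (ext iT WT) (- XT (int t)) (pCons a c)) d =
      fls_const (coeff a d) - fls_X_intpow (int t) * coeff (ext (ext iT WT) (- XT (int t)) c) d"
    by (simp add: ext_pCons[OF rhom_ext[OF rhom_iT]] ext_iT_WT_coeff XT_def)
  then have *: "coeff (ext (ext iT WT) (- XT (int t)) (pCons a c)) d $$ e =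
      (if e = 0 then coeff a d else 0) - coeff (ext (ext iT WT) (- XT (int t)) c) d $$ (e - int t)"
    by (simp add: fls_X_intpow_times_conv_shift)
  consider "e = 0" | "\<not> int t dvd e" | "e < 0" | j where "e = int t * (1 + int j)"
  proof -
    have "\<exists>j. e = int t * (1 + int j)" if "int t dvd e" "e > 0"
    proof -
      obtain q where q: "e = int t * q" using \<open>int t dvd e\<close> by (elim dvdE)
      then have "q > 0" using that assms by (simp add: zero_less_mult_iff)
      then show ?thesis using q by (intro exI[of _ "nat (q - 1)"]) simp
    qed
    then show ?thesis using that by fastforce
  qed
  then show ?case
  proof cases
    case 1
    then show ?thesis using assms unfolding * by (simp add: pCons.IH)
  next
    case 2
    then have "\<not> int t dvd e - int t" by (metis diff_add_cancel dvd_add_triv_right_iff)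
    moreover from 2 have "e \<noteq> 0" by auto
    ultimately show ?thesis using 2 unfolding * by (simp add: pCons.IH)
  next
    case 3
    then show ?thesis using assms unfolding * by (simp add: pCons.IH)
  next
    case 4
    have "e > 0" using 4 assms by (simp add: zero_less_mult_iff)
    then have "e \<noteq> 0" by simp
    moreover have "e - int t = int t * int j" "e div int t = 1 + int j" "e \<ge> 0" "int t dvd e"
      using 4 assms by (simp_all add: algebra_simps)
    moreover have "(int t * int j) div int t = int j" using assms by simp
    moreover have "nat (1 + int j) = Suc j" by simp
    ultimately show ?thesis
      unfolding * by (simp add: pCons.IH)
  qed
qed

text \<open>Linear independence of \<open>1, r, \<dots>, r\<^sup>t\<^sup>-\<^sup>1\<close> over \<open>k[x, f]\<close> on the cuspidal curve parametrised by
  \<open>f = -\<tau>\<^sup>t\<close>, \<open>r = (-1)\<^sup>l\<tau>\<^sup>s\<close>.\<close>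

lemma coeff_cusp_independent:
  fixes c :: "nat \<Rightarrow> 'k::field poly poly"
  assumes "t > 0" "coprime s t"
    and "(\<Sum>i<t. ext (ext iT WT) (- XT (int t)) (c i) * ((- 1) ^ l * XT (int s)) ^ i) = 0" "i < t"
  shows "c i = 0"
proof -
  have "coeff (coeff (c i) j) d = 0" for j d
  proof -
    let ?N = "int (s * i) + int t * int j"
    have pw: "((- 1) ^ l * XT (int s)) ^ i = [:(- 1) ^ (l * i) * fls_X_intpow (int (s * i)) :: 'k fls:]" for i
    proof -
      have "(- 1 :: 'k fls poly) ^ n = [:(- 1) ^ n:]" for n
        by (induction n) (simp_all add: one_pCons)
      moreover have "((- 1) ^ l * XT (int s) :: 'k fls poly) ^ i = (- 1) ^ (l * i) * XT (int (s * i))"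
        by (simp only: power_mult_distrib XT_power power_mult[symmetric] of_nat_mult mult.commute[of "int i"])
      ultimately show ?thesis by (simp add: XT_def)
    qed
    have sg: "(- 1 :: 'k fls) ^ n = fls_const ((- 1) ^ n)" for n
      by (induction n) (simp_all flip: fls_const_uminus)
    have coeff_term: "coeff (A * ((- 1) ^ l * XT (int s)) ^ i) d $$ N = (- 1) ^ (l * i) * coeff A d $$ (N - int (s * i))"
      for A :: "'k fls poly" and i N
    proof -
      have e: "A * ((- 1) ^ l * XT (int s)) ^ i = smult (fls_const ((- 1) ^ (l * i)) * fls_X_intpow (int (s * i))) A"
        unfolding pw sg by simp
      show ?thesis
        unfolding e coeff_smult mult.assoc fls_X_intpow_times_conv_shift(1) by simp
    qed
    have "0 = coeff (\<Sum>i<t. ext (ext iT WT) (- XT (int t)) (c i) * ((- 1) ^ l * XT (int s)) ^ i) d $$ ?N"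
      using assms by simp
    also have "\<dots> = (\<Sum>i'<t. (- 1) ^ (l * i') * coeff (ext (ext iT WT) (- XT (int t)) (c i')) d $$ (?N - int (s * i')))"
      by (simp only: coeff_sum fls_nth_sum coeff_term)
    also have "\<dots> = (\<Sum>i'<t. if i' = i then (- 1) ^ (l * i) * (- 1) ^ j * coeff (coeff (c i) j) d else 0)"
    proof (rule sum.cong)
      fix k assume k: "k \<in> {..<t}"
      show "(- 1) ^ (l * k) * coeff (ext (ext iT WT) (- XT (int t)) (c k)) d $$ (?N - int (s * k)) =
        (if k = i then (- 1) ^ (l * i) * (- 1) ^ j * coeff (coeff (c i) j) d else 0)"
      proof (cases "k = i")
        case True
        have "int t * int j div int t = int j" using assms by simp
        then show ?thesis using True assms by (simp add: coeff_ext_ext_iT)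
      next
        case False
        \<comment> \<open>Coprimality of \<open>s\<close> and \<open>t\<close> makes the residues of
          \<open>s * i\<close> modulo \<open>t\<close> distinct for \<open>i < t\<close>, so only
          one summand contributes at the exponent \<open>?N\<close>.\<close>
        have "\<not> int t dvd ?N - int (s * k)"
        proof
          assume "int t dvd ?N - int (s * k)"
          moreover have "?N - int (s * k) = int s * (int i - int k) + int t * int j"
            by (simp add: algebra_simps)
          ultimately have "int t dvd int s * (int i - int k)"
            by (metis dvd_add_times_triv_right_iff mult.commute)
          then have "int t dvd int i - int k"
            using assms(2) by (simp add: coprime_dvd_mult_right_iff coprime_commute)
          moreover have "\<bar>int i - int k\<bar> < int t" "int i - int k \<noteq> 0"
            using k False assms(4) by auto
          ultimately show False
            using zdvd_not_zless[of "\<bar>int i - int k\<bar>" "int t"] by simp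
        qed
        then show ?thesis using False assms by (simp add: coeff_ext_ext_iT)
      qed
    qed simp
    also have "\<dots> = (- 1) ^ (l * i) * (- 1) ^ j * coeff (coeff (c i) j) d"
      using assms(4) by simp
    finally show ?thesis by simp
  qed
  then show ?thesis by (intro poly_eqI) simp
qed

unbundle no fps_syntax

section \<open>The surfaces f = 0 and g = 0\<close>

text \<open>Divisibility is often obtained only up to a power of \<open>X1\<close> or
  \<open>f\<close>; this removes it. A prime \<open>x\<close> not dividing \<open>f\<close> must
  divide the cofactor of \<open>f\<close>, so one factor cancels at a time.\<close>

lemma prime_elem_cancel_power:
  fixes x :: "'a::idom"
  assumes "prime_elem x" "\<not> x dvd f" "f dvd x ^ n * P"
  shows "f dvd P"
  using assms(3)
proof (induction n)
  case (Suc n)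
  then obtain q where q: "x ^ Suc n * P = f * q" by (elim dvdE)
  then have "x dvd f * q" by (metis dvd_triv_left mult.assoc power_Suc)
  then obtain q' where "q = x * q'"
    using assms(1,2) by (metis dvdE prime_elem_dvd_mult_iff)
  then have "x * (x ^ n * P) = x * (f * q')" using q by (simp add: algebra_simps)
  then have "x ^ n * P = f * q'" using assms(1) by simp
  then show ?case using Suc.IH by simp
qed simp

lemma prime_elem_X1: "prime_elem (X1 :: 'k::field R3)"
proof -
  have "prime_elem [:0, 1 :: 'k:]"
  proof (rule prime_elemI)
    show "\<not> is_unit [:0, 1 :: 'k:]" by (simp add: is_unit_pCons_iff)
    show "[:0, 1:] dvd a \<or> [:0, 1:] dvd b" if "[:0, 1:] dvd a * b" for a b :: "'k poly"
      using that poly_eq_0_iff_dvd[of _ 0] by (metis minus_zero mult_eq_0_iff poly_mult)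
  qed simp
  then show ?thesis by (simp add: X1_def prime_elem_const_poly_iff)
qed

locale surface_data =
  fixes l m t :: nat and f g r :: "'k::field R3"
  assumes l: "l \<ge> 1" and m: "m \<ge> 1" and t: "t \<ge> 2" and mt: "m * t \<ge> 3"
    and f_def: "f = fpol t" and g_def: "g = gpol l m t" and r_def: "r = rpol l m t"
begin

lemma f_eq: "f = X1 * X3 - X2 ^ t"
  by (simp add: f_def fpol_def)

lemma r_eq: "r = f ^ l * X2 + X1 ^ m"
  by (simp add: r_def f_def rpol_def)

text \<open>The cofactor of \<open>r - f ^ l * X2\<close>, that is of \<open>X1 ^ m\<close>, in a
  difference of \<open>t\<close>-th powers. It yields a division-free formula for
  \<open>g\<close>.\<close>

definition Spol :: "'k R3" where
  "Spol = (\<Sum>i<t. (f ^ l * X2) ^ (t - Suc i) * r ^ i)"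

lemma r_power_t: "r ^ t = (f ^ l * X2) ^ t + X1 ^ m * Spol"
proof -
  have "r - f ^ l * X2 = X1 ^ m" by (simp add: r_eq)
  then have "r ^ t - (f ^ l * X2) ^ t = X1 ^ m * Spol"
    using power_diff_sumr2[of r t "f ^ l * X2"] by (simp only: Spol_def)
  then show ?thesis by (simp only: diff_eq_eq add.commute)
qed

text \<open>Modulo \<open>X1\<close>, \<open>r\<close> is \<open>f ^ l * X2\<close> and
  \<open>f\<close> is \<open>- (X2 ^ t)\<close>, so the two summands cancel. The explicit cofactor
  shows that \<open>g\<close> is a polynomial.\<close>

lemma X1_g': "f ^ (l * t + 1) + r ^ t = X1 * (f ^ (l * t) * X3 + X1 ^ (m - 1) * Spol)"
proof -
  have "f ^ (l * t + 1) = f ^ (l * t) * (X1 * X3 - X2 ^ t)"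
    by (simp flip: f_eq)
  moreover have Xm: "X1 ^ m = X1 * (X1 :: 'k R3) ^ (m - 1)" using m by (cases m) auto
  ultimately have "f ^ (l * t + 1) + r ^ t =
      f ^ (l * t) * (X1 * X3 - X2 ^ t) + (f ^ (l * t) * X2 ^ t + X1 * X1 ^ (m - 1) * Spol)"
    by (simp only: r_power_t Xm power_mult_distrib power_mult)
  moreover have "F * (x * z - y) + (F * y + x * w * s) = x * (F * z + w * s)" for F x y z w s :: "'k R3"
    by (simp add: algebra_simps)
  ultimately show ?thesis by simp
qed

lemma g_eq: "g = f ^ (l * t) * X3 + X1 ^ (m - 1) * Spol"
proof -
  have "(X1 :: 'k R3) \<noteq> 0" by (simp add: X1_def)
  then show ?thesis
    unfolding g_def gpol_def f_def[symmetric] r_def[symmetric] X1_g' by simp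
qed

lemma X1_g: "X1 * g = f ^ (l * t + 1) + r ^ t"
  by (simp only: X1_g' g_eq)

section \<open>The parametrisation \<open>phif\<close> of the surface \<open>f = 0\<close>\<close>

definition phif :: "'k R3 \<Rightarrow> 'k fls poly" where
  "phif = ev3 iT (XT 1) WT (XT (- 1) * WT ^ t)"

lemma rhom_phif: "rhom phif"
  unfolding phif_def by (intro rhom_ev3 rhom_iT)

lemma phif_simps: "phif X1 = XT 1" "phif X2 = WT" "phif X3 = XT (- 1) * WT ^ t" "phif (cR c) = iT c"
  unfolding phif_def by (simp_all add: ev3_simps[OF rhom_iT])

lemma phif_f: "phif f = 0"
  by (simp add: f_eq rhom.hom[OF rhom_phif] phif_simps mult.assoc[symmetric] XT_mult)

lemma phif_r: "phif r = XT (int m)"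
  using l by (simp add: r_eq rhom.hom[OF rhom_phif] phif_simps phif_f XT_power)

lemma phif_g: "phif g = XT (int (m * t - 1))"
proof -
  have "XT 1 * phif g = phif (X1 * g)"
    by (simp add: rhom.hom[OF rhom_phif] phif_simps)
  also have "\<dots> = XT (int m) ^ t"
    unfolding X1_g by (simp add: rhom.hom[OF rhom_phif] phif_f phif_r)
  also have "\<dots> = XT 1 * XT (int (m * t - 1))"
  proof -
    have "int t * int m = 1 + int (m * t - 1)" using mt by (simp add: mult.commute flip: of_nat_mult)
    then show ?thesis by (simp add: XT_power XT_mult)
  qed
  finally show ?thesis by (simp only: mult_left_cancel[OF XT_nonzero])
qed

lemma not_X1_dvd_f: "\<not> X1 dvd f"
proof
  \<comment> \<open>At the point (0, 1, 0) \<open>X1\<close> vanishes while \<open>f\<close> is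
    -1.\<close>
  have h: "rhom (ev3 (\<lambda>c::'k. c) 0 1 0)" by (intro rhom_ev3) (unfold_locales, auto)
  have i: "rhom (\<lambda>c::'k. c)" by unfold_locales auto
  assume "X1 dvd f"
  then have "ev3 (\<lambda>c. c) 0 1 0 X1 dvd ev3 (\<lambda>c. c) 0 1 0 f" by (rule rhom.dvd[OF h])
  then show False by (simp add: f_eq rhom.hom[OF h] ev3_simps[OF i])
qed

lemma f_poly: "f = [: - ([:0, 1:] ^ t), [:[:0, 1:]:] :]"
  unfolding f_eq X1_def X2_def X3_def by (simp add: rhom.power[OF rhom_pC, symmetric])

lemma degree_f: "degree f = 1"
  unfolding f_poly by simp

text \<open>\<open>f\<close> is linear in \<open>X3\<close> with leading coefficient
  \<open>X1\<close>. Pseudo-division leaves a remainder free of \<open>X3\<close>, on which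
  \<open>phif\<close> is injective; the power of \<open>X1\<close> is then cancelled.\<close>

lemma phif_kernel:
  assumes "phif P = 0" shows "f dvd P"
proof -
  define x where "x = [:0, 1 :: 'k:]"
  have x: "x \<noteq> 0" by (simp add: x_def)
  then have f0: "f \<noteq> 0" "degree f = 1" "coeff f 1 = [:x:]" by (simp_all add: f_poly x_def)
  obtain q s where qs: "pseudo_divmod P f = (q, s)" by fastforce
  define n where "n = Suc (degree P) - 1"
  have 1: "smult ([:x:] ^ n) P = f * q + s" "s = 0 \<or> degree s < 1"
    using pseudo_divmod[OF f0(1) qs] by (simp_all add: f0[unfolded One_nat_def] n_def)
  then have "degree s = 0" by auto
  then obtain c where s: "s = [:c:]" by (auto elim: degree_eq_zeroE)
  have X1P: "X1 ^ n * P = f * q + s"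
    unfolding 1(1)[symmetric]
    by (simp add: X1_def rhom.power[OF rhom_pC, symmetric] x_def)
  have "phif s = 0"
    using arg_cong[OF X1P, of phif] by (simp add: rhom.hom[OF rhom_phif] assms phif_f)
  then have "ext (ext iT (XT 1)) WT c = 0"
    by (simp add: s phif_def ev3_def ext_const[OF rhom_ext[OF rhom_ext[OF rhom_iT]]])
  then have "c = 0" by (rule ext_ext_iT_inj)
  then have "f dvd X1 ^ n * P" using X1P s by simp
  then show ?thesis
    by (rule prime_elem_cancel_power[OF prime_elem_X1 not_X1_dvd_f])
qed

lemma f_nonzero: "f \<noteq> 0"
  using not_X1_dvd_f by auto

text \<open>\<open>phif\<close> embeds the quotient by \<open>f\<close> into a domain.\<close>

lemma prime_elem_f: "prime_elem f"
proof (rule prime_elemI[OF f_nonzero])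
  show "\<not> is_unit f"
    using rhom.dvd[OF rhom_phif, of f 1] by (auto simp: phif_f rhom.one[OF rhom_phif])
  fix a b assume "f dvd a * b"
  then have "phif (a * b) = 0"
    using rhom.dvd[OF rhom_phif] phif_f by fastforce
  then show "f dvd a \<or> f dvd b"
    by (auto simp: rhom.mult[OF rhom_phif] intro: phif_kernel)
qed

lemma f_dvd_iff: "f dvd P \<longleftrightarrow> phif P = 0"
  using phif_kernel rhom.dvd[OF rhom_phif, of f P] by (auto simp: phif_f)

lemma not_f_dvd_g: "\<not> f dvd g"
  by (simp add: f_dvd_iff phif_g)

lemma g_nonzero: "g \<noteq> 0"
  using not_f_dvd_g by auto

text \<open>At the points (0, 1, z) the values of \<open>f\<close>, \<open>r\<close> and
  \<open>Spol\<close> do not depend on z, so \<open>g\<close> is \<open>(- 1) ^ (l * t) * z\<close>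
  plus a constant and cannot vanish at both z = 0 and z = 1.\<close>

lemma not_X1_dvd_g: "\<not> X1 dvd g"
proof
  define e where "e z = ev3 (\<lambda>c::'k. c) 0 1 z" for z
  have i: "rhom (\<lambda>c::'k. c)" by unfold_locales auto
  have h: "rhom (e z)" for z unfolding e_def by (intro rhom_ev3 i)
  have ef: "e z f = - 1" for z
    using t by (simp add: f_eq rhom.hom[OF h]) (simp add: e_def ev3_simps[OF i])
  have er: "e z r = (- 1) ^ l" for z
    using m by (simp add: r_eq rhom.hom[OF h] ef) (simp add: e_def ev3_simps[OF i])
  define c where "c = e 0 Spol"
  have eS: "e z Spol = c" for z
    unfolding c_def
    unfolding Spol_def by (simp add: rhom.hom[OF h] ef er) (simp add: e_def ev3_simps[OF i])
  have eg: "e z g = (- 1) ^ (l * t) * z + 0 ^ (m - 1) * c" for z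
    unfolding g_eq rhom.hom[OF h] ef eS by (simp add: e_def ev3_simps[OF i])
  assume "X1 dvd g"
  then have "e z X1 dvd e z g" for z by (rule rhom.dvd[OF h])
  then have "e z g = 0" for z by (simp add: e_def ev3_simps[OF i])
  then have "0 ^ (m - 1) * c = 0" "(- 1) ^ (l * t) + 0 ^ (m - 1) * c = 0"
    using eg[of 0] eg[of 1] by simp_all
  then have "(- 1 :: 'k) ^ (l * t) = 0" by (metis add.right_neutral)
  then show False by simp
qed

section \<open>The parametrisation \<open>phig\<close> of the surface \<open>g = 0\<close>\<close>

definition YT :: "'k fls poly" where
  "YT = XT 1 - (- 1) ^ l * XT (- int (l * t)) * WT ^ m"

definition ZT :: "'k fls poly" where
  "ZT = (YT ^ t - XT (int t)) div WT"

text \<open>The division in \<open>ZT\<close> is exact because \<open>YT\<close> is congruent to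
  \<open>XT 1\<close> modulo \<open>WT\<close>, as \<open>m\<close> is positive.\<close>

lemma WT_ZT: "WT * ZT = YT ^ t - XT (int t)"
proof -
  have "WT dvd YT - XT 1" using m by (auto simp: YT_def dvd_power)
  also have "YT - XT 1 dvd YT ^ t - XT 1 ^ t"
    by (simp add: power_diff_sumr2)
  finally show ?thesis by (simp add: ZT_def XT_power)
qed

text \<open>On \<open>g = 0\<close> the relation between \<open>f\<close> and \<open>r\<close> is a
  cusp, parametrised by \<open>f = -\<tau>^t\<close> and \<open>r = (-1)^l \<tau>^(l*t+1)\<close>.
  With W for \<open>X1\<close>, \<open>YT\<close> solves the equation of \<open>r\<close> for
  \<open>X2\<close>, and \<open>ZT\<close> that of \<open>f\<close> for \<open>X3\<close>.\<close>

definition phig :: "'k R3 \<Rightarrow> 'k fls poly" where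
  "phig = ev3 iT WT YT ZT"

lemma rhom_phig: "rhom phig"
  unfolding phig_def by (intro rhom_ev3 rhom_iT)

lemma phig_simps: "phig X1 = WT" "phig X2 = YT" "phig X3 = ZT" "phig (cR c) = iT c"
  unfolding phig_def by (simp_all add: ev3_simps[OF rhom_iT])

lemma phig_f: "phig f = - XT (int t)"
  by (simp add: f_eq rhom.hom[OF rhom_phig] phig_simps WT_ZT)

lemma phig_r: "phig r = (- 1) ^ l * XT (int (l * t + 1))"
proof -
  have "phig r = (- 1) ^ l * XT (int (l * t)) * YT + WT ^ m"
    by (simp add: r_eq rhom.hom[OF rhom_phig] phig_simps phig_f XT_power power_minus[of "XT _"])
  also have "\<dots> = (- 1) ^ l * (XT (int (l * t)) * XT 1) - ((- 1) ^ l * (- 1) ^ l) * (XT (int (l * t)) * XT (- int (l * t))) * WT ^ m + WT ^ m"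
    unfolding YT_def by (simp only: algebra_simps)
  also have "(- 1 :: 'k fls poly) ^ l * (- 1) ^ l = 1"
    by (simp flip: power_mult_distrib)
  finally show ?thesis by (simp add: XT_mult add.commute)
qed

lemma phig_g: "phig g = 0"
proof -
  have "WT * phig g = phig (X1 * g)"
    by (simp add: rhom.hom[OF rhom_phig] phig_simps)
  also have "\<dots> = (- XT (int t)) ^ (l * t + 1) + ((- 1) ^ l * XT (int (l * t + 1))) ^ t"
    unfolding X1_g by (simp only: rhom.hom[OF rhom_phig] phig_f phig_r)
  also have "\<dots> = 0"
    by (simp only: power_minus[of "XT _"] power_mult_distrib XT_power)
      (simp add: power_mult[symmetric] algebra_simps)
  finally show ?thesis by simp
qed

text \<open>Once \<open>X1\<close> and \<open>f\<close> are inverted, the equation of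
  \<open>r\<close> gives \<open>X2\<close> and then that of \<open>f\<close> gives \<open>X3\<close>
  in terms of \<open>X1\<close>, \<open>f\<close>, \<open>r\<close>.\<close>

lemma localize:
  "\<exists>N Q. (X1 * f) ^ N * P = ev3 cR X1 f r Q"
proof (induction P rule: R3_induct)
  case (const c)
  show ?case by (rule exI[of _ 0], rule exI[of _ "cR c"]) (simp add: ev3_simps[OF rhom_cR])
next
  case X1
  show ?case by (rule exI[of _ 0], rule exI[of _ X1]) (simp add: ev3_simps[OF rhom_cR])
next
  case X2
  have "(X1 * f) ^ l * X2 = X1 ^ l * (r - X1 ^ m)"
    by (simp add: r_eq power_mult_distrib)
  also have "\<dots> = ev3 cR X1 f r (X1 ^ l * (X3 - X1 ^ m))"
    by (simp add: rhom.hom[OF rhom_ev3[OF rhom_cR]] ev3_simps[OF rhom_cR])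
  finally show ?case by blast
next
  case X3
  have 1: "f ^ (l * t) * X2 ^ t = (r - X1 ^ m) ^ t"
    by (simp add: r_eq power_mult_distrib power_mult)
  have "X1 * X3 = f + X2 ^ t" by (simp add: f_eq)
  have "X1 * f ^ (l * t) * X3 = f ^ (l * t) * (X1 * X3)" by (simp only: mult_ac)
  also have "\<dots> = f ^ (l * t) * f + (r - X1 ^ m) ^ t"
    unfolding \<open>X1 * X3 = f + X2 ^ t\<close> 1[symmetric] by (simp only: distrib_left)
  finally have "X1 * f ^ (l * t) * X3 = f ^ (l * t) * f + (r - X1 ^ m) ^ t" .
  moreover have "(X1 * f) ^ (l * t) * X3 = X1 ^ (l * t - 1) * (X1 * f ^ (l * t) * X3)"
  proof -
    have "l * t \<ge> 1" using l t by simp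
    then have "X1 ^ (l * t) = X1 ^ (l * t - 1) * (X1 :: 'k R3)" by (metis power_minus_mult mult.commute zero_less_one_class.zero_less_one order_less_le_trans)
    then show ?thesis by (simp add: power_mult_distrib)
  qed
  ultimately have "(X1 * f) ^ (l * t) * X3 = ev3 cR X1 f r (X1 ^ (l * t - 1) * (X2 ^ (l * t) * X2 + (X3 - X1 ^ m) ^ t))"
    by (simp add: rhom.hom[OF rhom_ev3[OF rhom_cR]] ev3_simps[OF rhom_cR])
  then show ?case by blast
next
  case (add a b)
  then obtain N Q N' Q' where N: "(X1 * f) ^ N * a = ev3 cR X1 f r Q" "(X1 * f) ^ N' * b = ev3 cR X1 f r Q'"
    by blast
  have "(X1 * f) ^ (N + N') * (a + b) = (X1 * f) ^ N' * ((X1 * f) ^ N * a) + (X1 * f) ^ N * ((X1 * f) ^ N' * b)"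
    by (simp add: power_add algebra_simps)
  also have "\<dots> = ev3 cR X1 f r ((X1 * X2) ^ N' * Q + (X1 * X2) ^ N * Q')"
    unfolding N by (simp add: rhom.hom[OF rhom_ev3[OF rhom_cR]] ev3_simps[OF rhom_cR])
  finally show ?case by blast
next
  case (mult a b)
  then obtain N Q N' Q' where N: "(X1 * f) ^ N * a = ev3 cR X1 f r Q" "(X1 * f) ^ N' * b = ev3 cR X1 f r Q'"
    by blast
  have "(X1 * f) ^ (N + N') * (a * b) = ((X1 * f) ^ N * a) * ((X1 * f) ^ N' * b)"
    by (simp add: power_add mult_ac)
  also have "\<dots> = ev3 cR X1 f r (Q * Q')"
    unfolding N by (simp add: rhom.hom[OF rhom_ev3[OF rhom_cR]])
  finally show ?case by blast
qed

text \<open>After localisation, \<open>r ^ t\<close> is reduced modulo \<open>X1 * g\<close>. The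
  remainder has degree below \<open>t\<close> in \<open>r\<close>; as \<open>l * t + 1\<close> is
  coprime to \<open>t\<close>, its vanishing on the cusp forces its coefficients to vanish. The
  primes \<open>X1\<close> and \<open>f\<close> do not divide \<open>g\<close> and cancel.\<close>

lemma phig_kernel:
  assumes "phig P = 0" shows "g dvd P"
proof -
  let ?E = "ev3 cR X1 f r"
  have E: "rhom ?E" by (rule rhom_ev3[OF rhom_cR])
  obtain N Q where N: "(X1 * f) ^ N * P = ?E Q" using localize by blast
  have t0: "t > 0" using t by simp
  \<comment> \<open>In \<open>Q\<close> the variables stand for \<open>X1\<close>, \<open>f\<close>,
    \<open>r\<close> in this order, so \<open>?E\<close> maps the divisor to
    \<open>r ^ t + f ^ (l * t + 1)\<close>, which is \<open>X1 * g\<close>.\<close>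
  obtain Q' b where Q: "Q = Q' * ([:0, 1:] ^ t - [:- ([:0, 1:] ^ (l * t + 1)):]) + (\<Sum>j<t. [:b j:] * [:0, 1:] ^ j)"
    using monic_binomial_reduce[OF t0] by blast
  have "?E [:- ([:0, 1:] ^ (l * t + 1)):] = - (f ^ (l * t + 1))"
  proof -
    have "[:- ([:0, 1:] ^ (l * t + 1)):] = - (X2 ^ (l * t + 1) :: 'k R3)"
      by (simp only: X2_def rhom.power[OF rhom_pC, symmetric]) simp
    then show ?thesis by (simp only: rhom.hom[OF E] ev3_simps[OF rhom_cR])
  qed
  then have EQ: "?E Q = ?E Q' * (X1 * g) + (\<Sum>j<t. ?E [:b j:] * r ^ j)"
    unfolding Q X1_g X3_def[symmetric]
    by (simp only: rhom.hom[OF E] ev3_simps[OF rhom_cR] diff_minus_eq_add add.commute[of "r ^ t"])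
  have phE: "phig (?E u) = ev3 iT WT (- XT (int t)) ((- 1) ^ l * XT (int (l * t + 1))) u" for u
    by (rule R3_hom_eqI[OF rhom_comp[OF rhom_phig E] rhom_ev3[OF rhom_iT]])
      (simp_all only: ev3_simps[OF rhom_cR] ev3_simps[OF rhom_iT] phig_simps phig_f phig_r)
  have "phig (?E Q) = 0"
    using arg_cong[OF N, of phig] assms by (simp add: rhom.hom[OF rhom_phig])
  then have "(\<Sum>j<t. phig (?E [:b j:]) * phig r ^ j) = 0"
    unfolding EQ by (simp add: rhom.hom[OF rhom_phig] phig_g)
  then have "(\<Sum>j<t. ext (ext iT WT) (- XT (int t)) (b j) * ((- 1) ^ l * XT (int (l * t + 1))) ^ j) = 0"
    by (simp only: phE phig_r) (simp add: ev3_def ext_const[OF rhom_ext[OF rhom_ext[OF rhom_iT]]])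
  moreover have "coprime (l * t + 1) t"
    by (metis coprime_iff_gcd_eq_1 gcd_1_nat gcd.commute gcd_add_mult mult.commute add.commute)
  ultimately have "b j = 0" if "j < t" for j
    using coeff_cusp_independent[OF t0, of "l * t + 1" b l j] that by simp
  then have "?E Q = ?E Q' * (X1 * g)"
    unfolding EQ by (simp add: rhom.zero[OF E])
  then have "g dvd X1 ^ N * (f ^ N * P)"
    using N by (simp add: power_mult_distrib mult.assoc)
  then have "g dvd f ^ N * P"
    by (rule prime_elem_cancel_power[OF prime_elem_X1 not_X1_dvd_g])
  moreover have "\<not> f dvd g" by (rule not_f_dvd_g)
  ultimately show ?thesis
    using prime_elem_cancel_power[OF prime_elem_f] by blast
qed

lemma g_dvd_iff: "g dvd P \<longleftrightarrow> phig P = 0"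
  using phig_kernel rhom.dvd[OF rhom_phig, of g P] by (auto simp: phig_g)

end

section \<open>Polynomials in r over C\<close>

text \<open>Substituting for \<open>r\<close> and then specialising T is a single evaluation; this
  turns \<open>eps_tilde\<close> at T = \<open>h\<close> into a shift of \<open>r\<close>.\<close>

lemma poly_poly_map_pC:
  "poly (poly (map_poly (\<lambda>c. [:c:]) u) q) x = poly u (poly q x)" for u :: "'a::comm_ring_1 poly"
  by (induction u) (simp_all add: map_poly_pCons)

locale is_subring =
  fixes A :: "'a::comm_ring_1 set"
  assumes one: "1 \<in> A" and minus: "a \<in> A \<Longrightarrow> - a \<in> A"
    and add: "a \<in> A \<Longrightarrow> b \<in> A \<Longrightarrow> a + b \<in> A"
    and mult: "a \<in> A \<Longrightarrow> b \<in> A \<Longrightarrow> a * b \<in> A"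
begin

lemma diff: "a \<in> A \<Longrightarrow> b \<in> A \<Longrightarrow> a - b \<in> A"
  using add[of a "- b"] minus by simp

lemma zero: "0 \<in> A"
  using diff[OF one one] by simp

lemma power: "a \<in> A \<Longrightarrow> a ^ n \<in> A"
  by (induction n) (auto intro: one mult)

lemma sum: "(\<And>i. i \<in> I \<Longrightarrow> s i \<in> A) \<Longrightarrow> sum s I \<in> A"
  by (induction I rule: infinite_finite_induct) (auto intro: zero add)

lemma is_subring_polys_over: "is_subring (polys_over A)"
  by unfold_locales
    (auto simp: polys_over_def coeff_1 coeff_mult intro!: zero one minus add sum mult)

lemma const_mem: "c \<in> A \<Longrightarrow> [:c:] \<in> polys_over A"
  by (auto simp: polys_over_def coeff_pCons zero split: nat.splits)

lemma X_mem: "[:0, 1:] \<in> polys_over A"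
  by (auto simp: polys_over_def coeff_pCons zero one split: nat.splits)

lemma pcompose_mem:
  assumes "u \<in> polys_over A" "v \<in> polys_over A"
  shows "pcompose u v \<in> polys_over A"
  unfolding pcompose_altdef poly_altdef
  by (rule is_subring.sum[OF is_subring_polys_over], rule is_subring.mult[OF is_subring_polys_over],
      use assms(1) in \<open>auto simp: polys_over_def coeff_map_poly coeff_pCons zero split: nat.splits\<close>)
    (use is_subring.power[OF is_subring_polys_over assms(2)] in \<open>auto simp: polys_over_def\<close>)

end

context surface_data
begin

section \<open>The variables as rational expressions in \<open>f\<close>, \<open>g\<close>,
  \<open>r\<close>\<close>

abbreviation XK :: "'k K3 poly" where "XK \<equiv> [:0, 1:]"

text \<open>These formulas solve for x1, x2, x3 when \<open>f\<close>, \<open>g\<close>,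
  \<open>r\<close> are prescribed to be \<open>F\<close>, \<open>G\<close> and the variable
  \<open>XK\<close>.\<close>

definition xU :: "'k K3 \<Rightarrow> 'k K3 \<Rightarrow> 'k K3 poly" where
  "xU F G = [:inverse G:] * ([:F ^ (l * t + 1):] + XK ^ t)"
definition yU :: "'k K3 \<Rightarrow> 'k K3 \<Rightarrow> 'k K3 poly" where
  "yU F G = [:inverse (F ^ l):] * (XK - xU F G ^ m)"
definition SU :: "'k K3 \<Rightarrow> 'k K3 \<Rightarrow> 'k K3 poly" where
  "SU F G = (\<Sum>i<t. ([:F ^ l:] * yU F G) ^ (t - Suc i) * XK ^ i)"
text \<open>Solving \<open>g_eq\<close> for x3 divides only by a power of \<open>F\<close>, whereas
  the equation of \<open>f\<close> would require division by \<open>xU F G\<close>, which is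
  nonconstant in \<open>XK\<close>.\<close>

definition zU :: "'k K3 \<Rightarrow> 'k K3 \<Rightarrow> 'k K3 poly" where
  "zU F G = [:inverse (F ^ (l * t)):] * ([:G:] - xU F G ^ (m - 1) * SU F G)"
text \<open>Three choices of \<open>F\<close> and \<open>G\<close> occur: \<open>f\<close>,
  \<open>g\<close> expand a polynomial in powers of \<open>r\<close> over \<open>C\<close>;
  \<open>X1\<close>, \<open>X2\<close> give algebraic independence; \<open>f ^ p\<close>,
  \<open>g ^ p\<close> describe \<open>psi\<close>.\<close>

definition Uh :: "'k K3 \<Rightarrow> 'k K3 \<Rightarrow> 'k R3 \<Rightarrow> 'k K3 poly" where
  "Uh F G = ev3 (\<lambda>c. [:cK c:]) (xU F G) (yU F G) (zU F G)"

lemma rhom_const_cK: "rhom (\<lambda>c :: 'k. [:cK c:])"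
  by (rule rhom_comp[OF rhom_pC rhom_cK])

lemma rhom_Uh: "rhom (Uh F G)"
  unfolding Uh_def by (rule rhom_ev3[OF rhom_const_cK])

lemma Uh_simps: "Uh F G X1 = xU F G" "Uh F G X2 = yU F G" "Uh F G X3 = zU F G" "Uh F G (cR c) = [:cK c:]"
  unfolding Uh_def by (simp_all add: ev3_simps[OF rhom_const_cK])

context
  fixes F G :: "'k K3"
  assumes F: "F \<noteq> 0" and G: "G \<noteq> 0"
begin

lemma xU_eq: "[:G:] * xU F G = [:F:] ^ (l * t + 1) + XK ^ t"
proof -
  have "[:G:] * [:inverse G:] = 1" using G by (simp add: one_pCons)
  then have "[:G:] * xU F G = [:F ^ (l * t + 1):] + XK ^ t"
    unfolding xU_def by (simp only: mult.assoc[symmetric] mult_1)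
  then show ?thesis by (simp only: rhom.power[OF rhom_pC])
qed

lemma yU_eq: "[:F:] ^ l * yU F G = XK - xU F G ^ m"
proof -
  have "[:F ^ l:] * [:inverse (F ^ l):] = 1" using F by (simp add: one_pCons)
  then show ?thesis
    unfolding yU_def by (simp only: rhom.power[OF rhom_pC, symmetric] mult.assoc[symmetric] mult_1)
qed

lemma zU_eq: "[:F:] ^ (l * t) * zU F G = [:G:] - xU F G ^ (m - 1) * SU F G"
proof -
  have "[:F ^ (l * t):] * [:inverse (F ^ (l * t)):] = 1" using F by (simp add: one_pCons)
  then show ?thesis
    unfolding zU_def by (simp only: rhom.power[OF rhom_pC, symmetric] mult.assoc[symmetric] mult_1)
qed

lemma SU_eq: "XK ^ t - ([:F:] ^ l * yU F G) ^ t = xU F G ^ m * SU F G"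
  using power_diff_sumr2[of XK t "[:F:] ^ l * yU F G"]
  by (simp only: SU_def yU_eq rhom.power[OF rhom_pC, symmetric]) (simp only: rhom.power[OF rhom_pC] yU_eq, simp)

lemma xU_nonzero: "xU F G \<noteq> 0"
proof
  assume "xU F G = 0"
  then have "coeff ([:F:] ^ (l * t + 1) + XK ^ t) t = 0"
    unfolding xU_eq[symmetric] by simp
  then show False
    using t by (simp add: rhom.power[OF rhom_pC, symmetric] coeff_pCons monom_altdef[of 1, simplified, symmetric]
        del: power_Suc split: nat.splits)
qed

text \<open>After multiplication by \<open>[:F:] ^ (l * t)\<close>, the formula for
  \<open>zU\<close> and the difference of powers in \<open>SU_eq\<close> leave
  \<open>[:F:] + yU F G ^ t\<close> for the product of x1 and x3.\<close>

lemma Uh_f: "Uh F G f = [:F:]"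
proof -
  have "m = Suc (m - 1)" using m by simp
  then have xm: "xU F G ^ m = xU F G * xU F G ^ (m - 1)" by (metis power_Suc)
  have "[:F:] ^ (l * t) * (xU F G * zU F G) = xU F G * ([:G:] - xU F G ^ (m - 1) * SU F G)"
    unfolding zU_eq[symmetric] by (simp only: mult_ac)
  also have "\<dots> = [:G:] * xU F G - xU F G ^ m * SU F G"
    unfolding xm by (simp only: algebra_simps)
  also have "\<dots> = [:F:] ^ (l * t) * ([:F:] + yU F G ^ t)"
    unfolding SU_eq[symmetric] xU_eq
    by (simp only: power_mult_distrib power_mult[symmetric] power_add) (simp add: distrib_left)
  finally have "xU F G * zU F G = [:F:] + yU F G ^ t"
    using F by simp
  then show ?thesis
    unfolding f_eq by (simp add: rhom.hom[OF rhom_Uh] Uh_simps)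
qed

lemma Uh_r: "Uh F G r = XK"
  unfolding r_eq by (simp only: rhom.hom[OF rhom_Uh] Uh_simps Uh_f yU_eq) simp

lemma Uh_g: "Uh F G g = [:G:]"
proof -
  have "xU F G * Uh F G g = Uh F G (X1 * g)"
    by (simp only: rhom.hom[OF rhom_Uh] Uh_simps)
  also have "\<dots> = xU F G * [:G:]"
    unfolding X1_g by (simp only: rhom.hom[OF rhom_Uh] Uh_f Uh_r xU_eq[symmetric] mult.commute)
  finally show ?thesis by (simp only: mult_left_cancel[OF xU_nonzero])
qed

lemma Uh_mem:
  assumes "is_subring A" "\<And>c. cK c \<in> A" "F \<in> A" "G \<in> A" "inverse F \<in> A" "inverse G \<in> A"
  shows "Uh F G P \<in> polys_over A"
proof -
  interpret A: is_subring A by fact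
  interpret P: is_subring "polys_over A" by (rule A.is_subring_polys_over)
  note I = P.add P.diff P.mult P.power P.sum A.const_mem A.X_mem A.power
  have x: "xU F G \<in> polys_over A"
    unfolding xU_def using assms by (intro I)
  have y: "yU F G \<in> polys_over A"
    unfolding yU_def power_inverse[symmetric] using assms x by (intro I)
  have s: "SU F G \<in> polys_over A"
    unfolding SU_def using assms y by (intro I)
  have z: "zU F G \<in> polys_over A"
    unfolding zU_def power_inverse[symmetric] using assms x s by (intro I)
  show ?thesis
  proof (induction P rule: R3_induct)
    case (add a b) then show ?case by (simp only: rhom.hom[OF rhom_Uh] P.add)
  next
    case (mult a b) then show ?case by (simp only: rhom.hom[OF rhom_Uh] P.mult)
  qed (use x y z assms in \<open>simp_all only: Uh_simps A.const_mem\<close>)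
qed

end

section \<open>The ring \<open>C\<close> and the transcendence of \<open>r\<close> over it\<close>

definition ev2 :: "'k poly poly \<Rightarrow> 'k R3" where
  "ev2 = ext (ext cR f) g"

lemma rhom_ev2: "rhom ev2"
  unfolding ev2_def by (intro rhom_ext rhom_cR)

lemma ev2_simps: "ev2 [:[:c:]:] = cR c" "ev2 [:[:0, 1:]:] = f" "ev2 [:0, 1:] = g"
  by (simp_all add: ev2_def ext_const ext_X rhom_ext rhom_cR)

lemma range_ev2: "kalg cR {f, g} = range ev2"
proof
  show "kalg cR {f, g} \<subseteq> range ev2"
  proof (rule kalg_least)
    show "{f, g} \<subseteq> range ev2" using ev2_simps(2,3) by (metis empty_subsetI insert_subset rangeI)
    show "cR c \<in> range ev2" for c using ev2_simps(1) by (metis rangeI)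
  qed (auto simp: rhom.add[OF rhom_ev2, symmetric] rhom.mult[OF rhom_ev2, symmetric])
  have 1: "ext cR f c \<in> kalg cR {f, g}" for c
    by (induction c rule: poly_ring_induct)
      (auto simp: ext_const[OF rhom_cR] ext_X[OF rhom_cR] rhom.hom[OF rhom_ext[OF rhom_cR]] intro: kalg.intros)
  have "ev2 u \<in> kalg cR {f, g}" for u
    by (induction u rule: poly_ring_induct)
      (auto simp: rhom.hom[OF rhom_ev2] ev2_simps intro: kalg.intros,
       auto simp: ev2_def ext_const[OF rhom_ext[OF rhom_cR]] 1)
  then show "range ev2 \<subseteq> kalg cR {f, g}" by auto
qed

abbreviation "C \<equiv> Cring (emb f) (emb g)"

text \<open>A power of the single element \<open>f * g\<close> serves as denominator, so
  denominators of finitely many coefficients can be cleared together.\<close>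

lemma mem_C: "c \<in> C \<longleftrightarrow> (\<exists>N Q. emb (f * g) ^ N * c = emb (ev2 Q))"
proof -
  note E = rhom.hom[OF rhom_emb]
  have K: "kalg cK {emb f, emb g} = emb ` range ev2"
    using kalg_image[OF rhom_emb, of cR cK "{f, g}"] by (simp add: cK_def range_ev2)
  have nz: "emb f \<noteq> 0" "emb g \<noteq> 0" using f_nonzero g_nonzero by simp_all
  show ?thesis
  proof
    assume "c \<in> C"
    then obtain Q i j where c: "c = emb (ev2 Q) * inverse (emb f ^ i * emb g ^ j)"
      unfolding Cring_def K by auto
    have "emb (f * g) ^ (i + j) * c = emb (f ^ j * g ^ i * ev2 Q)"
      unfolding c using nz by (simp add: E power_mult_distrib power_add field_simps)
    also have "\<dots> = emb (ev2 ([:[:0, 1:]:] ^ j * [:0, 1:] ^ i * Q))"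
      by (simp only: rhom.hom[OF rhom_ev2] ev2_simps)
    finally show "\<exists>N Q. emb (f * g) ^ N * c = emb (ev2 Q)" by blast
  next
    assume "\<exists>N Q. emb (f * g) ^ N * c = emb (ev2 Q)"
    then obtain N Q where "emb (f * g) ^ N * c = emb (ev2 Q)" by blast
    then have "c = emb (ev2 Q) * inverse (emb f ^ N * emb g ^ N)"
      using nz by (simp add: E power_mult_distrib field_simps)
    then show "c \<in> C" unfolding Cring_def K by auto
  qed
qed

lemma ev2_mem_C: "emb (ev2 Q) \<in> C"
  unfolding mem_C by (rule exI[of _ 0], rule exI[of _ Q]) simp

lemma is_subring_C: "is_subring C"
proof
  note E = rhom.hom[OF rhom_emb]
  note E2 = rhom.hom[OF rhom_ev2]
  show "1 \<in> C" using ev2_mem_C[of 1] by (simp add: E E2)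
  fix a assume "a \<in> C"
  then obtain N Q where a: "emb (f * g) ^ N * a = emb (ev2 Q)" unfolding mem_C by blast
  then have "emb (f * g) ^ N * - a = emb (ev2 (- Q))" by (simp add: E E2)
  then show "- a \<in> C" unfolding mem_C by blast
  fix b assume "b \<in> C"
  then obtain N' Q' where b: "emb (f * g) ^ N' * b = emb (ev2 Q')" unfolding mem_C by blast
  have "emb (f * g) ^ (N + N') * (a * b) = emb (f * g) ^ N * a * (emb (f * g) ^ N' * b)"
    by (simp only: power_add mult_ac)
  also have "\<dots> = emb (ev2 (Q * Q'))" unfolding a b by (simp only: E E2)
  finally show "a * b \<in> C" unfolding mem_C by blast
  have "emb (f * g) ^ (N + N') * (a + b) =
      emb (f * g) ^ N' * (emb (f * g) ^ N * a) + emb (f * g) ^ N * (emb (f * g) ^ N' * b)"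
    by (simp only: power_add algebra_simps)
  also have "\<dots> = emb (ev2 (([:[:0, 1:]:] * [:0, 1:]) ^ N' * Q + ([:[:0, 1:]:] * [:0, 1:]) ^ N * Q'))"
    unfolding a b by (simp only: E E2 ev2_simps)
  finally show "a + b \<in> C" unfolding mem_C by blast
qed

sublocale C: is_subring C by (rule is_subring_C)
sublocale CX: is_subring "polys_over C" by (rule C.is_subring_polys_over)

lemma C_mem: "emb f \<in> C" "emb g \<in> C" "cK c \<in> C" "inverse (emb f) \<in> C" "inverse (emb g) \<in> C"
proof -
  show "emb f \<in> C" "emb g \<in> C" "cK c \<in> C"
    using ev2_mem_C[of "[:[:0, 1:]:]"] ev2_mem_C[of "[:0, 1:]"] ev2_mem_C[of "[:[:c:]:]"]
    by (simp_all only: ev2_simps cK_def)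
  have "emb (f * g) ^ 1 * inverse (emb f) = emb (ev2 [:0, 1:])"
    "emb (f * g) ^ 1 * inverse (emb g) = emb (ev2 [:[:0, 1:]:])"
    using f_nonzero g_nonzero by (simp_all only: ev2_simps rhom.hom[OF rhom_emb]) (simp_all add: field_simps)
  then show "inverse (emb f) \<in> C" "inverse (emb g) \<in> C" unfolding mem_C by blast+
qed

text \<open>Algebraic independence of \<open>f\<close>, \<open>g\<close>, \<open>r\<close>:
  \<open>?U\<close> takes them to x1, x2 and \<open>XK\<close>, and specialising \<open>XK\<close>
  to x3 recovers \<open>P\<close>.\<close>

lemma ev3_fgr_inj:
  assumes "ev3 cR f g r P = 0" shows "P = 0"
proof -
  have nz: "emb X1 \<noteq> (0 :: 'k K3)" "emb X2 \<noteq> (0 :: 'k K3)" by (simp_all add: X1_def X2_def)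
  let ?U = "Uh (emb X1) (emb X2)"
  have E: "rhom (ev3 cR f g r)" by (rule rhom_ev3[OF rhom_cR])
  have "poly (?U (ev3 cR f g r P)) (emb X3) = emb P"
    by (rule R3_hom_eqI[OF rhom_comp[OF rhom_poly rhom_comp[OF rhom_Uh E]] rhom_emb])
      (simp_all add: ev3_simps[OF rhom_cR] Uh_f[OF nz] Uh_g[OF nz] Uh_r[OF nz] Uh_simps cK_def)
  then show ?thesis
    using assms by (simp add: rhom.zero[OF rhom_Uh])
qed

lemma clear_denominators:
  assumes "u \<in> polys_over C"
  shows "\<exists>N P. smult (emb (f * g) ^ N) u = map_poly (\<lambda>c. emb (ev2 c)) P"
  using assms
proof (induction u)
  case 0
  show ?case by (rule exI[of _ 0], rule exI[of _ 0]) simp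
next
  case (pCons a u)
  have EE: "rhom (\<lambda>c. emb (ev2 c))" by (rule rhom_comp[OF rhom_emb rhom_ev2])
  have "coeff (pCons a u) 0 \<in> C" "coeff (pCons a u) (Suc i) \<in> C" for i
    using pCons.prems unfolding polys_over_def by blast+
  then have a: "a \<in> C" and u: "u \<in> polys_over C" by (simp_all add: polys_over_def)
  obtain N Q where N: "emb (f * g) ^ N * a = emb (ev2 Q)" using a unfolding mem_C by blast
  obtain N' P where N': "smult (emb (f * g) ^ N') u = map_poly (\<lambda>c. emb (ev2 c)) P"
    using pCons.IH[OF u] by blast
  let ?w = "[:[:0, 1:]:] * [:0, 1:] :: 'k poly poly"
  have w: "emb (ev2 ?w) = emb (f * g)"
    by (simp only: rhom.mult[OF rhom_ev2] ev2_simps)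
  have "smult (emb (f * g) ^ (N + N')) (pCons a u) =
      pCons (emb (f * g) ^ N' * (emb (f * g) ^ N * a)) (smult (emb (f * g) ^ N) (smult (emb (f * g) ^ N') u))"
    by (simp add: power_add mult_ac)
  also have "\<dots> = map_poly (\<lambda>c. emb (ev2 c)) (pCons (?w ^ N' * Q) (smult (?w ^ N) P))"
    unfolding N N' unfolding w[symmetric]
    by (simp only: map_poly_pCons[of "\<lambda>c. emb (ev2 c)", OF rhom.zero[OF EE]]
        map_poly_smult[of "\<lambda>c. emb (ev2 c)", OF rhom.zero[OF EE] rhom.mult[OF EE]]
        rhom.power[OF EE] rhom.mult[OF EE] rhom.power[OF EE, symmetric])
  finally show ?case by blast
qed

text \<open>Clearing denominators reduces the transcendence of \<open>r\<close> over
  \<open>C\<close> to algebraic independence. It makes the polynomial in \<open>eps_tilde\<close>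
  unique.\<close>

lemma polys_over_C_zeroI:
  assumes "u \<in> polys_over C" "poly u (emb r) = 0"
  shows "u = 0"
proof -
  obtain N P where P: "smult (emb (f * g) ^ N) u = map_poly (\<lambda>c. emb (ev2 c)) P"
    using clear_denominators[OF assms(1)] by blast
  have EE: "rhom (\<lambda>c. emb (ev2 c))" by (rule rhom_comp[OF rhom_emb rhom_ev2])
  have "emb (ev3 cR f g r P) = ext (\<lambda>c. emb (ev2 c)) (emb r) P"
    unfolding ev3_def ev2_def[symmetric]
    by (rule poly_hom_eqI[OF rhom_comp[OF rhom_emb rhom_ext[OF rhom_ev2]] rhom_ext[OF EE]])
      (simp_all add: ext_const ext_X EE rhom_ev2)
  also have "\<dots> = 0"
    unfolding ext_def P[symmetric] by (simp add: assms)
  finally have "P = 0" using ev3_fgr_inj by simp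
  then have "smult (emb (f * g) ^ N) u = 0" using P by simp
  then show ?thesis using f_nonzero g_nonzero by simp
qed

lemma polys_over_C_eqI:
  assumes "u \<in> polys_over C" "v \<in> polys_over C" "poly u (emb r) = poly v (emb r)"
  shows "u = v"
  using polys_over_C_zeroI[of "u - v"] CX.diff[OF assms(1,2)] assms(3) by simp

text \<open>Uniqueness behind \<open>psi\<close>: composition with \<open>XK ^ p\<close>, of
  positive degree, is injective.\<close>

lemma polys_over_C_eqI_power:
  assumes "u \<in> polys_over C" "v \<in> polys_over C" "poly u (emb r ^ p) = poly v (emb r ^ p)" "p > 0"
  shows "u = v"
proof -
  have Xp: "XK ^ p \<in> polys_over C" by (rule CX.power[OF C.X_mem])
  have "pcompose (u - v) (XK ^ p) = 0"
    by (rule polys_over_C_zeroI)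
      (use assms C.pcompose_mem[OF CX.diff[OF assms(1,2)] Xp] in \<open>auto simp: poly_pcompose\<close>)
  moreover have "degree (XK ^ p) > 0" using assms(4) by (simp add: degree_power_eq)
  ultimately have "u - v = 0" by (rule pcompose_eq_0)
  then show ?thesis by simp
qed

section \<open>Closed forms of \<open>eps_h\<close> and \<open>psi\<close>\<close>

abbreviation "U \<equiv> Uh (emb f) (emb g)"

lemma emb_fg_nonzero: "emb f \<noteq> 0" "emb g \<noteq> 0"
  using f_nonzero g_nonzero by simp_all

lemma U_mem: "U P \<in> polys_over C"
  by (rule Uh_mem[OF emb_fg_nonzero is_subring_C]) (intro C_mem)+

text \<open>Multiplied by \<open>g\<close>, \<open>f ^ l\<close> and \<open>X1\<close> respectively,
  the three variables become polynomials in elements whose images are already known, and these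
  factors cancel in the field.\<close>

lemma hom_eq_embI:
  assumes "rhom \<phi>" "\<And>c. \<phi> (cR c) = cK c" "\<phi> f = emb f" "\<phi> g = emb g" "\<phi> r = emb r"
  shows "\<phi> P = emb P"
proof -
  note h = rhom.hom[OF assms(1)]
  note e = rhom.hom[OF rhom_emb]
  have x0: "emb X1 \<noteq> (0 :: 'k K3)" by (simp add: X1_def)
  have "emb g * \<phi> X1 = \<phi> (X1 * g)" by (simp add: h assms)
  also have "\<dots> = emb g * emb X1"
    unfolding X1_g h assms by (simp only: e[symmetric] X1_g[symmetric] mult.commute)
  finally have x: "\<phi> X1 = emb X1" using emb_fg_nonzero by simp
  have "f ^ l * X2 = r - X1 ^ m" by (simp add: r_eq)
  then have "\<phi> (f ^ l * X2) = emb (f ^ l * X2)"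
    by (simp only: h e assms x)
  then have "emb f ^ l * \<phi> X2 = emb f ^ l * emb X2"
    by (simp only: h e assms)
  then have y: "\<phi> X2 = emb X2" using emb_fg_nonzero by simp
  have "X1 * X3 = f + X2 ^ t" by (simp add: f_eq)
  then have "\<phi> (X1 * X3) = emb (X1 * X3)"
    by (simp only: h e assms y)
  then have "emb X1 * \<phi> X3 = emb X1 * emb X3"
    by (simp only: h e x)
  then have z: "\<phi> X3 = emb X3" using x0 by simp
  show ?thesis
    by (rule R3_hom_eqI[OF assms(1) rhom_emb]) (simp_all add: assms x y z cK_def)
qed

lemma poly_U_r: "poly (U P) (emb r) = emb P"
  by (rule hom_eq_embI[OF rhom_comp[OF rhom_poly rhom_Uh]])
    (simp_all add: Uh_simps Uh_f[OF emb_fg_nonzero] Uh_g[OF emb_fg_nonzero] Uh_r[OF emb_fg_nonzero])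

text \<open>\<open>U b\<close> is the unique polynomial over \<open>C\<close> with value
  \<open>emb b\<close> at \<open>emb r\<close>, so it is the one selected in
  \<open>eps_tilde\<close>.\<close>

lemma eps_h_eq: "eps_h l m t h b = poly (U b) (emb r + emb (f ^ l * g * h))"
proof -
  have "eps_tilde l m t (emb b) = poly (map_poly (\<lambda>c. [:c:]) (U b)) [:emb r, emb f ^ l * emb g:]"
    unfolding eps_tilde_def f_def[symmetric] g_def[symmetric] r_def[symmetric]
  proof (rule the_equality)
    show "\<exists>u\<in>polys_over C. emb b = poly u (emb r) \<and>
      poly (map_poly (\<lambda>c. [:c:]) (U b)) [:emb r, emb f ^ l * emb g:] =
      poly (map_poly (\<lambda>c. [:c:]) u) [:emb r, emb f ^ l * emb g:]"
      using U_mem poly_U_r by metis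
    fix e assume "\<exists>u\<in>polys_over C. emb b = poly u (emb r) \<and>
      e = poly (map_poly (\<lambda>c. [:c:]) u) [:emb r, emb f ^ l * emb g:]"
    then obtain u where u: "u \<in> polys_over C" "emb b = poly u (emb r)"
      "e = poly (map_poly (\<lambda>c. [:c:]) u) [:emb r, emb f ^ l * emb g:]" by blast
    then have "u = U b" using polys_over_C_eqI[OF u(1) U_mem] by (simp add: poly_U_r)
    then show "e = poly (map_poly (\<lambda>c. [:c:]) (U b)) [:emb r, emb f ^ l * emb g:]" using u(3) by simp
  qed
  then show ?thesis
    unfolding eps_h_def by (simp add: poly_poly_map_pC rhom.hom[OF rhom_emb] mult_ac)
qed

lemma psi_eq:
  assumes "u \<in> polys_over C" "p > 0"
  shows "psi p l m t h (poly u (emb r ^ p)) = poly u (emb (qpol p l m t h))"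
  unfolding psi_def f_def[symmetric] g_def[symmetric] r_def[symmetric]
  by (rule the_equality) (use assms polys_over_C_eqI_power in blast)+

end

section \<open>Generators of the five-variable ring and Artin-Schreier invariants\<close>

lemma diff_power_prime_CHAR:
  fixes x y :: "'a::comm_ring_1"
  assumes "prime p" "CHAR('a) = p"
  shows "(x - y) ^ p = x ^ p - y ^ p"
proof -
  have "(x - y + y) ^ p = (x - y) ^ p + y ^ p"
    by (rule freshmans_dream) (simp_all add: assms)
  then show ?thesis by (simp add: eq_diff_eq)
qed

lemma of_nat_power_CHAR:
  assumes "prime p" "CHAR('a::comm_ring_1) = p"
  shows "(of_nat i :: 'a) ^ p = of_nat i"
proof (induction i)
  case 0
  then show ?case using assms by (simp add: prime_gt_0_nat power_0_left)
next
  case (Suc i)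
  have "(1 + of_nat i :: 'a) ^ p = 1 ^ p + of_nat i ^ p"
    by (rule freshmans_dream) (simp_all add: assms)
  then show ?case using Suc by simp
qed

lemma (in is_subring) ext_mem:
  assumes "rhom \<phi>" "\<And>c. \<phi> c \<in> A" "a \<in> A"
  shows "ext \<phi> a P \<in> A"
  using assms by (induction P) (auto simp: ext_pCons intro: add mult zero)

lemma is_subring_kalg:
  assumes "rhom i" shows "is_subring (kalg i S)"
proof
  show "1 \<in> kalg i S" using kalg.const[of i 1] by (simp add: rhom.one[OF assms])
  show "- a \<in> kalg i S" if "a \<in> kalg i S" for a
    using kalg.mult[OF kalg.const[of i "- 1"] that] by (simp add: rhom.hom[OF assms])
qed (auto intro: kalg.intros)

lemma is_subring_range: "rhom \<phi> \<Longrightarrow> is_subring (range \<phi>)"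
  by unfold_locales
    (auto simp: rhom.hom[of \<phi>, symmetric] simp del: add_uminus_conv_diff intro: range_eqI[of _ _ 1])

section \<open>The five-variable ring and its normal form\<close>

definition ev5 :: "'k::field R3 \<Rightarrow> 'k R3 \<Rightarrow> 'k R3 \<Rightarrow> 'k R3 \<Rightarrow> 'k R3 \<Rightarrow> 'k R5 \<Rightarrow> 'k R3" where
  "ev5 a b c d e = ext (ext (ev3 cR a b c) d) e"

lemma rhom_ev5: "rhom (ev5 a b c d e)"
  unfolding ev5_def by (intro rhom_ext rhom_ev3 rhom_cR)

lemma rhom_incl35: "rhom (incl35 :: 'k::field R3 \<Rightarrow> _)"
  by unfold_locales (simp_all add: incl35_def one_pCons)

lemma ev5_simps:
  "ev5 a b c d e (incl35 u) = ev3 cR a b c u" "ev5 a b c d e Y5 = d" "ev5 a b c d e Z5 = e"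
  "ev5 a b c d e (cR5 k) = cR k"
  by (simp_all add: ev5_def incl35_def Y5_def Z5_def cR5_def ext_const ext_X rhom_ext rhom_ev3
      rhom_cR ev3_simps)

lemma range_ev5: "range (ev5 a b c d e) = kalg cR {a, b, c, d, e}"
proof
  interpret K: is_subring "kalg cR {a, b, c, d, e}" by (rule is_subring_kalg[OF rhom_cR])
  show "range (ev5 a b c d e) \<subseteq> kalg cR {a, b, c, d, e}"
    unfolding ev5_def ev3_def
    by (intro image_subsetI K.ext_mem rhom_ext rhom_cR kalg.const) (auto intro: kalg.gen)
  have "ev5 a b c d e ` {incl35 X1, incl35 X2, incl35 X3, Y5, Z5} = {a, b, c, d, e}"
    by (simp add: ev5_simps ev3_simps[OF rhom_cR])
  then have "{a, b, c, d, e} \<subseteq> range (ev5 a b c d e)" by blast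
  then show "kalg cR {a, b, c, d, e} \<subseteq> range (ev5 a b c d e)"
    by (intro kalg_least)
      (auto simp: rhom.add[OF rhom_ev5, symmetric] rhom.mult[OF rhom_ev5, symmetric]
        simp flip: ev5_simps(4)[of a b c d e])
qed

text \<open>Division by \<open>Z5 ^ p - incl35 g\<close> in the outer variable, then division of
  every coefficient by \<open>Y5 ^ p - incl35 f\<close>.\<close>

lemma R5_normal_form:
  fixes P :: "'k::field R5"
  assumes "p > 0"
  obtains A B c where "P = A * (Y5 ^ p - incl35 f) + B * (Z5 ^ p - incl35 g) +
    (\<Sum>i<p. \<Sum>j<p. incl35 (c i j) * Y5 ^ i * Z5 ^ j)"
proof -
  obtain B b where P: "P = B * (Z5 ^ p - incl35 g) + (\<Sum>j<p. [:b j:] * Z5 ^ j)"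
    using monic_binomial_reduce[OF assms, of P "[:g:]"] unfolding Z5_def incl35_def by blast
  have "\<exists>Qc. b j = fst Qc * ([:0, 1:] ^ p - [:f:]) + (\<Sum>i<p. [:snd Qc i:] * [:0, 1:] ^ i)" for j
  proof -
    obtain Q c where "b j = Q * ([:0, 1:] ^ p - [:f:]) + (\<Sum>i<p. [:c i:] * [:0, 1:] ^ i)"
      using monic_binomial_reduce[OF assms] by blast
    then show ?thesis by (intro exI[of _ "(Q, c)"]) (simp only: fst_conv snd_conv)
  qed
  from choice[OF allI, OF this] obtain Qc where Qc:
    "\<forall>j. b j = fst (Qc j) * ([:0, 1:] ^ p - [:f:]) + (\<Sum>i<p. [:snd (Qc j) i:] * [:0, 1:] ^ i)" ..
  define Q c where "Q j = fst (Qc j)" and "c j = snd (Qc j)" for j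
  note b = Qc[rule_format, folded Q_def c_def]
  have "[:b j:] = [:Q j:] * (Y5 ^ p - incl35 f) + (\<Sum>i<p. incl35 (c j i) * Y5 ^ i)" for j
    unfolding b rhom.add[OF rhom_pC] rhom.diff[OF rhom_pC] rhom.mult[OF rhom_pC] rhom.sum[OF rhom_pC]
      rhom.power[OF rhom_pC] by (simp only: Y5_def incl35_def)
  note bj = this
  have "[:b j:] * Z5 ^ j = [:Q j:] * Z5 ^ j * (Y5 ^ p - incl35 f) + (\<Sum>i<p. incl35 (c j i) * Y5 ^ i * Z5 ^ j)" for j
    unfolding bj distrib_right sum_distrib_right[symmetric] by (simp only: mult_ac)
  then have "P = B * (Z5 ^ p - incl35 g) + ((\<Sum>j<p. [:Q j:] * Z5 ^ j) * (Y5 ^ p - incl35 f) +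
      (\<Sum>j<p. \<Sum>i<p. incl35 (c j i) * Y5 ^ i * Z5 ^ j))"
    unfolding P sum_distrib_right sum.distrib[symmetric] by simp
  also have "(\<Sum>j<p. \<Sum>i<p. incl35 (c j i) * Y5 ^ i * Z5 ^ j) = (\<Sum>i<p. \<Sum>j<p. incl35 (c j i) * Y5 ^ i * Z5 ^ j)"
    by (rule sum.swap)
  finally show ?thesis
    by (intro that[of "\<Sum>j<p. [:Q j:] * Z5 ^ j" B "\<lambda>i j. c j i"]) (simp only: add_ac)
qed

section \<open>Polynomials invariant under a translation in characteristic p\<close>

lemma rhom_pcompose: "rhom (\<lambda>u :: 'a::comm_ring_1 poly. pcompose u q)"
  by unfold_locales (simp_all add: pcompose_1 pcompose_add pcompose_mult)

text \<open>Induction on the degree. Without its constant term, \<open>u\<close> vanishes at 0,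
  hence by invariance at the \<open>p\<close> multiples of \<open>a\<close>, which are the roots of
  \<open>Q\<close>. So \<open>Q\<close> divides it, and the quotient is again invariant and of
  smaller degree.\<close>

lemma artin_schreier_invariant:
  fixes a :: "'a::field"
  assumes A: "is_subring A" and p: "prime p" "CHAR('a) = p" and a: "a \<in> A" "a \<noteq> 0"
    and u: "u \<in> polys_over A" "pcompose u [:a, 1:] = u"
  shows "\<exists>v \<in> polys_over A. u = pcompose v ([:0, 1:] ^ p - [:a ^ (p - 1):] * [:0, 1:])"
  using u
proof (induction "degree u" arbitrary: u rule: less_induct)
  case less
  interpret is_subring A by fact
  interpret P: is_subring "polys_over A" by (rule is_subring_polys_over)
  define Q where "Q = [:0, 1:] ^ p - [:a ^ (p - 1):] * [:0, 1:]"
  have p2: "p \<ge> 2" using p by (simp add: prime_ge_2_nat)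
  have pa: "a ^ p = a ^ (p - 1) * a" using p2 by (metis power_minus_mult pos2 order_less_le_trans)
  have coeffQ: "coeff Q n = (if n = p then 1 else 0) - (if n = 1 then a ^ (p - 1) else 0)" for n
    by (auto simp: Q_def monom_altdef[of 1, simplified, symmetric] coeff_pCons split: nat.splits)
  have "degree Q \<le> p" by (rule degree_le) (use p2 in \<open>auto simp: coeffQ\<close>)
  moreover have "coeff Q p \<noteq> 0" using p2 by (simp add: coeffQ)
  ultimately have degQ: "degree Q = p" by (simp add: le_degree antisym)
  then have Q0: "Q \<noteq> 0" using p2 by auto
  have Qinv: "pcompose Q [:a, 1:] = Q"
  proof -
    have X: "[:a, 1:] = [:a:] + [:0, 1:]" by simp
    have "pcompose Q [:a, 1:] = ([:a:] + [:0, 1:]) ^ p - [:a ^ (p - 1):] * ([:a:] + [:0, 1:])"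
      unfolding Q_def X by (simp only: rhom.hom[OF rhom_pcompose]) (simp add: pcompose_pCons)
    also have "([:a:] + [:0, 1:]) ^ p = [:a:] ^ p + [:0, 1:] ^ p"
      by (rule freshmans_dream) (use p in auto)
    also have "[:a:] ^ p = [:a ^ (p - 1):] * [:a:]"
      unfolding rhom.power[OF rhom_pC, symmetric] pa by (rule rhom.mult[OF rhom_pC])
    finally show ?thesis unfolding Q_def by (simp only: algebra_simps) simp
  qed
  define w where "w = u - [:coeff u 0:]"
  have w: "w \<in> polys_over A"
    unfolding w_def using less.prems by (intro P.diff const_mem) (auto simp: polys_over_def)
  have winv: "pcompose w [:a, 1:] = w"
    unfolding w_def by (simp add: pcompose_diff less.prems)
  have "poly w (of_nat i * a) = 0" for i
  proof (induction i)
    case 0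
    then show ?case by (simp add: w_def poly_0_coeff_0)
  next
    case (Suc i)
    have "poly w (of_nat i * a + a) = poly (pcompose w [:a, 1:]) (of_nat i * a)"
      by (simp add: poly_pcompose add.commute)
    then show ?case unfolding winv Suc by (simp add: algebra_simps)
  qed
  moreover have "poly Q (of_nat i * a) = 0" for i
    using of_nat_power_CHAR[OF p, of i]
    by (simp add: Q_def power_mult_distrib pa)
  ultimately have roots: "poly (w mod Q) (of_nat i * a) = 0" for i
    by (simp add: minus_div_mult_eq_mod[symmetric])
  \<comment> \<open>The remainder has degree below \<open>p\<close> but \<open>p\<close> distinct
    roots.\<close>
  have "w mod Q = 0"
  proof (rule ccontr)
    assume nz: "w mod Q \<noteq> 0"
    have "inj_on (\<lambda>i. of_nat i * a) {..<p}"
    proof (rule linorder_inj_onI)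
      fix i j assume ij: "i < j" "i \<in> {..<p}" "j \<in> {..<p}"
      show "of_nat i * a \<noteq> of_nat j * a"
      proof
        assume "of_nat i * a = of_nat j * a"
        then have "of_nat (j - i) = (0 :: 'a)" using a ij by (simp add: of_nat_diff)
        then have "p dvd j - i" using p by (simp add: of_nat_eq_0_iff_char_dvd)
        then show False using ij by (auto dest!: dvd_imp_le)
      qed
    qed auto
    then have "p = card ((\<lambda>i. of_nat i * a) ` {..<p})" by (simp add: card_image)
    also have "\<dots> \<le> card {x. poly (w mod Q) x = 0}"
      by (rule card_mono[OF poly_roots_finite[OF nz]]) (use roots in auto)
    also have "\<dots> \<le> degree (w mod Q)" by (rule card_poly_roots_bound[OF nz])
    also have "\<dots> < p" using degree_mod_less[OF Q0, of w] nz degQ by auto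
    finally show False by simp
  qed
  then obtain u1 where wQ: "w = Q * u1" by (metis dvd_eq_mod_eq_0 dvdE)
  have uw: "u = [:coeff u 0:] + w" by (simp add: w_def)
  have "\<exists>v1 \<in> polys_over A. u1 = pcompose v1 Q"
  proof (cases "u1 = 0")
    case True
    then show ?thesis by (intro bexI[of _ 0]) (use P.zero in auto)
  next
    case False
    have "degree w = p + degree u1" unfolding wQ using False Q0 by (simp add: degree_mult_eq degQ)
    moreover have "degree w \<le> degree u" unfolding w_def by (rule degree_diff_le) auto
    ultimately have "degree u1 < degree u" using p2 by simp
    moreover have "pcompose u1 [:a, 1:] = u1"
    proof -
      have "Q * pcompose u1 [:a, 1:] = Q * u1"
        using winv unfolding wQ pcompose_mult Qinv .
      then show ?thesis using Q0 by simp
    qed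
    moreover have "u1 \<in> polys_over A"
    proof -
      have "coeff u1 n \<in> A" for n
      \<comment> \<open>Downward induction: as \<open>Q\<close> is monic, comparing coefficients of
        degree \<open>n + p\<close> in \<open>w = Q * u1\<close> expresses coefficient
        \<open>n\<close> of \<open>u1\<close> through the one of index \<open>n + p - 1\<close>,
        which exceeds \<open>n\<close> because \<open>p\<close> is at least 2.\<close>
      proof (induction "Suc (degree u1) - n" arbitrary: n rule: less_induct)
        case (less n)
        show ?case
        proof (cases "n > degree u1")
          case True
          then show ?thesis by (simp add: coeff_eq_0 zero)
        next
          case False
          have "Q * u1 = monom 1 p * u1 - smult (a ^ (p - 1)) (monom 1 1 * u1)"
            by (simp add: Q_def monom_altdef algebra_simps)
          then have "coeff w (n + p) = coeff u1 n - a ^ (p - 1) * coeff u1 (n + p - 1)"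
            unfolding wQ using p2 by (simp add: coeff_monom_mult)
          then have "coeff u1 n = coeff w (n + p) + a ^ (p - 1) * coeff u1 (n + p - 1)" by simp
          also have "\<dots> \<in> A"
            using w False p2 a by (intro add mult power less) (auto simp: polys_over_def)
          finally show ?thesis .
        qed
      qed
      then show ?thesis by (simp add: polys_over_def)
    qed
    ultimately show ?thesis using less.hyps[of u1] unfolding Q_def by blast
  qed
  then obtain v1 where v1: "v1 \<in> polys_over A" "u1 = pcompose v1 Q" by blast
  have "pCons (coeff u 0) v1 = [:coeff u 0:] + [:0, 1:] * v1" by simp
  also have "\<dots> \<in> polys_over A"
    using v1 less.prems by (intro P.add P.mult const_mem X_mem) (auto simp: polys_over_def)
  finally have "pCons (coeff u 0) v1 \<in> polys_over A" .
  moreover have "u = pcompose (pCons (coeff u 0) v1) Q"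
    using uw wQ v1 by (simp add: pcompose_pCons)
  ultimately show ?case unfolding Q_def by blast
qed

section \<open>The ring of invariants\<close>

locale invariant_data = surface_data +
  fixes p :: nat and h :: "'a::field R3"
  assumes CHAR_p: "CHAR('a) = p" and p_pos: "p > 0"
    and p_t: "\<not> p dvd t" and p_mt: "\<not> p dvd (m * t - 1)"
    and h_mem: "h \<in> kalg cR {f, g}"
    and h_div: "\<exists>a \<in> kalg cR {f, g}. h ^ (p - 1) = f ^ (l + 1) * g ^ 2 * a"
    and h_nz: "h ^ (p - 1) \<noteq> 0"
begin

lemma prime_p: "prime p"
  using prime_CHAR_semidom[where ?'a = 'a] CHAR_p p_pos by simp

lemma p2: "p \<ge> 2"
  using prime_p by (rule prime_ge_2_nat)

lemma CHAR_K: "CHAR('a K3) = p"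
proof (rule idom_CHAR_eqI[OF prime_p])
  have "of_nat n = emb (of_nat n)" for n
    by (induction n) (simp_all only: of_nat_0 of_nat_Suc rhom.hom[OF rhom_emb])
  moreover have "of_nat p = (0 :: 'a R3)" using CHAR_p by (simp add: of_nat_eq_0_iff_char_dvd)
  ultimately show "of_nat p = (0 :: 'a K3)" by (metis emb_eq_0_iff)
qed

lemma add_power_R: "(x + y) ^ p = x ^ p + y ^ p" for x y :: "'a R3"
  by (rule freshmans_dream) (simp_all add: prime_p CHAR_p)

lemma diff_power_R: "(x - y) ^ p = x ^ p - y ^ p" for x y :: "'a R3"
  by (rule diff_power_prime_CHAR) (simp_all add: prime_p CHAR_p)

lemma diff_power_T: "(x - y) ^ p = x ^ p - y ^ p" for x y :: "'a fls poly"
  by (rule diff_power_prime_CHAR) (simp_all add: prime_p CHAR_p)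

section \<open>The images \<open>xP\<close>, \<open>yP\<close>, \<open>zP\<close> of the p-th powers
  of the variables\<close>

abbreviation "q \<equiv> qpol p l m t h"
abbreviation "a\<^sub>0 \<equiv> f ^ l * g * h"

lemma q_eq: "q = r ^ p - a\<^sub>0 ^ (p - 1) * r"
  by (simp add: qpol_def f_def g_def r_def)

definition s :: "'a R3" where
  "s = (SOME a. h ^ (p - 1) = f ^ (l + 1) * g ^ 2 * a)"

text \<open>The divisibility of \<open>h ^ (p - 1)\<close> enters here. One factor \<open>f\<close>
  and one factor \<open>g\<close> survive division by the denominators \<open>g ^ p\<close> of x1^p
  and \<open>f ^ (l * p)\<close> of x2^p, whence the congruences modulo
  \<open>f * g\<close>.\<close>

lemma s_eq: "a\<^sub>0 ^ (p - 1) = f ^ (l * p + 1) * g ^ (p + 1) * s"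
proof -
  have "h ^ (p - 1) = f ^ (l + 1) * g ^ 2 * s"
    using h_div unfolding s_def by (metis (mono_tags, lifting) someI)
  then have "a\<^sub>0 ^ (p - 1) = (f ^ (l * (p - 1)) * f ^ (l + 1)) * (g ^ (p - 1) * g ^ 2) * s"
    by (simp only: power_mult_distrib power_mult mult_ac)
  also have "f ^ (l * (p - 1)) * f ^ (l + 1) = f ^ (l * p + 1)"
  proof -
    have "l * (p - 1) + (l + 1) = l * p + 1" using p2 by (cases p) auto
    then show ?thesis by (simp only: power_add[symmetric])
  qed
  also have "g ^ (p - 1) * g ^ 2 = g ^ (p + 1)"
  proof -
    have "(p - 1) + 2 = p + 1" using p2 by simp
    then show ?thesis by (simp only: power_add[symmetric])
  qed
  finally show ?thesis .
qed

lemma a0_nonzero: "a\<^sub>0 \<noteq> 0"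
  using h_nz f_nonzero g_nonzero p2 by (auto simp: power_0_left)

text \<open>Chosen so that \<open>q ^ t - (r ^ p) ^ t\<close> is
  \<open>g ^ p * (f ^ (l * p + 1) * g * W)\<close>, by extracting the factor
  \<open>q - r ^ p\<close>.\<close>

definition W :: "'a R3" where
  "W = - (s * r * (\<Sum>i<t. (r ^ p) ^ (t - Suc i) * q ^ i))"
definition xP :: "'a R3" where
  "xP = X1 ^ p + f ^ (l * p + 1) * g * W"
definition yP :: "'a R3" where
  "yP = X2 ^ p + f * g * - (g ^ p * s * r + W * (\<Sum>i<m. (X1 ^ p) ^ (m - Suc i) * xP ^ i))"
definition zP :: "'a R3" where
  "zP = (f ^ p + yP ^ t) div xP"

text \<open>The \<open>p\<close>-th power of \<open>X1_g\<close>, with \<open>q\<close> in place of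
  \<open>r ^ p\<close>; this identifies \<open>xP\<close> with the image of x1^p.\<close>

lemma xP_eq: "g ^ p * xP = (f ^ p) ^ (l * t + 1) + q ^ t"
proof -
  have "q - r ^ p = - (f ^ (l * p + 1) * g ^ (p + 1) * s * r)"
    unfolding q_eq s_eq by simp
  then have "q ^ t - (r ^ p) ^ t = - (f ^ (l * p + 1) * g ^ (p + 1) * s * r) * (\<Sum>i<t. (r ^ p) ^ (t - Suc i) * q ^ i)"
    unfolding power_diff_sumr2[of q t "r ^ p"] by (simp only:)
  also have "\<dots> = g ^ p * (f ^ (l * p + 1) * g * W)"
    unfolding W_def by (simp add: mult_ac)
  finally have "q ^ t = (r ^ p) ^ t + g ^ p * (f ^ (l * p + 1) * g * W)"
    by (simp only: diff_eq_eq add.commute)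
  moreover have "(g * X1) ^ p = (f ^ (l * t + 1)) ^ p + (r ^ t) ^ p"
    unfolding mult.commute[of g] X1_g by (rule add_power_R)
  then have "g ^ p * X1 ^ p = (f ^ p) ^ (l * t + 1) + (r ^ p) ^ t"
    by (simp only: power_mult_distrib power_mult[symmetric] mult.commute)
  ultimately show ?thesis
    unfolding xP_def distrib_left by (simp only: add.assoc)
qed

text \<open>The \<open>p\<close>-th power of the equation of \<open>r\<close>, with \<open>q\<close>
  for \<open>r ^ p\<close> and \<open>xP\<close> for \<open>X1 ^ p\<close>.\<close>

lemma yP_eq: "(f ^ p) ^ l * yP = q - xP ^ m"
proof -
  let ?e = "\<Sum>i<m. (X1 ^ p) ^ (m - Suc i) * xP ^ i"
  have 1: "xP ^ m - (X1 ^ p) ^ m = f ^ (l * p + 1) * g * W * ?e"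
    using power_diff_sumr2[of xP m "X1 ^ p"] by (simp add: xP_def)
  have "(f ^ l * X2) ^ p = (r - X1 ^ m) ^ p" by (simp add: r_eq)
  then have 2: "(f ^ p) ^ l * X2 ^ p = r ^ p - (X1 ^ p) ^ m"
    unfolding diff_power_R by (simp only: power_mult_distrib power_mult[symmetric] mult.commute)
  have 3: "(f ^ p) ^ l * f = f ^ (l * p + 1)" by (simp add: power_mult[symmetric] mult.commute)
  have "(f ^ p) ^ l * yP = (f ^ p) ^ l * X2 ^ p + (f ^ p) ^ l * f * g * - (g ^ p * s * r + W * ?e)"
    unfolding yP_def by (simp only: distrib_left mult.assoc)
  also have "\<dots> = r ^ p - (X1 ^ p) ^ m - f ^ (l * p + 1) * g * g ^ p * s * r - f ^ (l * p + 1) * g * W * ?e"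
  proof -
    have "A + F * G * - (H * s * r + w * e) = A - F * G * H * s * r - F * G * w * e" for A F G H w e s r :: "'a R3"
      by (simp add: algebra_simps)
    then show ?thesis unfolding 2 3 .
  qed
  also have "\<dots> = r ^ p - f ^ (l * p + 1) * g ^ (p + 1) * s * r - xP ^ m"
    unfolding 1[symmetric] by (simp add: mult_ac)
  finally show ?thesis unfolding q_eq s_eq .
qed

abbreviation "V \<equiv> Uh (emb f ^ p) (emb g ^ p)"

lemma emb_power_nonzero: "emb f ^ p \<noteq> 0" "emb g ^ p \<noteq> 0"
  using f_nonzero g_nonzero by simp_all

lemmas V_eqs = xU_eq[OF emb_power_nonzero] yU_eq[OF emb_power_nonzero] zU_eq[OF emb_power_nonzero]
lemmas V_fgr = Uh_f[OF emb_power_nonzero] Uh_g[OF emb_power_nonzero] Uh_r[OF emb_power_nonzero]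

lemma V_mem: "V P \<in> polys_over C"
  by (rule Uh_mem[OF emb_power_nonzero is_subring_C])
    (simp_all only: power_inverse[symmetric] C.power C_mem)

lemma not_f_dvd_xP: "\<not> f dvd xP"
  by (simp add: f_dvd_iff xP_def rhom.hom[OF rhom_phif] phif_f phif_simps)

lemma poly_V_xq: "poly (V X1) (emb q) = emb xP"
proof -
  have "emb g ^ p * poly (V X1) (emb q) = emb g ^ p * emb xP"
    using arg_cong[OF V_eqs(1), of "\<lambda>P. poly P (emb q)"] arg_cong[OF xP_eq, of emb]
    by (simp add: Uh_simps rhom.hom[OF rhom_emb])
  then show ?thesis using g_nonzero by simp
qed

lemma poly_V_yq: "poly (V X2) (emb q) = emb yP"
proof -
  have "(emb f ^ p) ^ l * poly (V X2) (emb q) = emb q - poly (V X1) (emb q) ^ m"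
    using arg_cong[OF V_eqs(2), of "\<lambda>P. poly P (emb q)"]
    by (simp add: Uh_simps)
  also have "\<dots> = (emb f ^ p) ^ l * emb yP"
    unfolding poly_V_xq by (simp only: rhom.hom[OF rhom_emb, symmetric] yP_eq)
  finally show ?thesis using f_nonzero by simp
qed

text \<open>The division defining \<open>zP\<close> must be shown to be exact. By the formula for
  \<open>zU\<close>, a power of \<open>f\<close> times the value \<open>?w\<close> is a polynomial,
  so \<open>xP\<close> divides \<open>f ^ p + yP ^ t\<close> up to a power of \<open>f\<close>, and
  the prime \<open>f\<close> does not divide \<open>xP\<close>.\<close>

lemma xP_zP_and_V: "xP * zP = f ^ p + yP ^ t \<and> poly (V X3) (emb q) = emb zP"
proof -
  let ?w = "poly (V X3) (emb q)"
  let ?D = "g ^ p - xP ^ (m - 1) * (\<Sum>i<t. ((f ^ p) ^ l * yP) ^ (t - Suc i) * q ^ i)"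
  have "V (X1 * X3 - X2 ^ t) = [:emb f ^ p:]"
    using V_fgr(1) unfolding f_eq[symmetric] .
  from arg_cong[OF this, of "\<lambda>P. poly P (emb q)"]
  have "emb xP * ?w - emb yP ^ t = emb f ^ p"
    by (simp add: rhom.hom[OF rhom_Uh] poly_V_xq poly_V_yq)
  then have xw: "emb xP * ?w = emb (f ^ p + yP ^ t)"
    by (simp add: rhom.hom[OF rhom_emb] diff_eq_eq)
  have "poly (SU (emb f ^ p) (emb g ^ p)) (emb q) = emb (\<Sum>i<t. ((f ^ p) ^ l * yP) ^ (t - Suc i) * q ^ i)"
    unfolding SU_def using poly_V_yq by (simp add: poly_sum rhom.hom[OF rhom_emb] Uh_simps)
  then have fw: "emb ((f ^ p) ^ (l * t)) * ?w = emb ?D"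
    using arg_cong[OF V_eqs(3), of "\<lambda>P. poly P (emb q)"] poly_V_xq
    by (simp add: rhom.hom[OF rhom_emb] Uh_simps)
  have "emb (f ^ (p * (l * t)) * (f ^ p + yP ^ t)) = emb xP * (emb ((f ^ p) ^ (l * t)) * ?w)"
    unfolding rhom.mult[OF rhom_emb] xw[symmetric] power_mult by (simp only: mult_ac)
  also have "\<dots> = emb (xP * ?D)" unfolding fw rhom.mult[OF rhom_emb] ..
  finally have "xP dvd f ^ (p * (l * t)) * (f ^ p + yP ^ t)" by simp
  then have "xP dvd f ^ p + yP ^ t"
    by (rule prime_elem_cancel_power[OF prime_elem_f not_f_dvd_xP])
  then have x: "xP * zP = f ^ p + yP ^ t" by (simp add: zP_def)
  have "xP \<noteq> 0" using not_f_dvd_xP by auto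
  moreover have "emb xP * ?w = emb xP * emb zP"
    unfolding xw x[symmetric] by (simp only: rhom.hom[OF rhom_emb])
  ultimately show ?thesis using x by simp
qed

lemmas xP_zP = xP_zP_and_V[THEN conjunct1]
lemmas poly_V_zq = xP_zP_and_V[THEN conjunct2]

section \<open>The endomorphism \<open>Phi\<close> and its restriction to the two surfaces\<close>

definition Phi :: "'a R3 \<Rightarrow> 'a R3" where "Phi = ev3 cR xP yP zP"

lemma rhom_Phi: "rhom Phi"
  unfolding Phi_def by (rule rhom_ev3[OF rhom_cR])

lemma Phi_simps: "Phi X1 = xP" "Phi X2 = yP" "Phi X3 = zP" "Phi (cR c) = cR c"
  unfolding Phi_def by (simp_all add: ev3_simps[OF rhom_cR])

lemma poly_V_q: "poly (V P) (emb q) = emb (Phi P)"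
  by (rule R3_hom_eqI[OF rhom_comp[OF rhom_poly rhom_Uh] rhom_comp[OF rhom_emb rhom_Phi]])
    (simp_all only: poly_V_xq poly_V_yq poly_V_zq Phi_simps, simp add: Uh_simps cK_def)

text \<open>\<open>V\<close> sends \<open>f\<close>, \<open>g\<close>, \<open>r\<close> to
  \<open>f ^ p\<close>, \<open>g ^ p\<close> and \<open>XK\<close>, and \<open>Phi\<close> is
  \<open>V\<close> evaluated at \<open>q\<close>.\<close>

lemma Phi_fgr: "Phi f = f ^ p" "Phi g = g ^ p" "Phi r = q"
proof -
  have "emb (Phi f) = emb (f ^ p)" "emb (Phi g) = emb (g ^ p)" "emb (Phi r) = emb q"
    unfolding poly_V_q[symmetric] V_fgr rhom.hom[OF rhom_emb] by simp_all
  then show "Phi f = f ^ p" "Phi g = g ^ p" "Phi r = q"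
    by (simp_all only: emb_eq_iff)
qed

text \<open>Evaluated at \<open>r ^ p\<close>, the same polynomials satisfy the \<open>p\<close>-th
  powers of the equations of \<open>f\<close>, \<open>g\<close>, \<open>r\<close>. Together with
  \<open>poly_V_q\<close> this computes \<open>psi\<close>.\<close>

lemma poly_V_r: "poly (V P) (emb r ^ p) = emb (ev3 cR (X1 ^ p) (X2 ^ p) (X3 ^ p) P)"
proof -
  note E = rhom.hom[OF rhom_emb]
  have "(g * X1) ^ p = (f ^ (l * t + 1)) ^ p + (r ^ t) ^ p"
    unfolding mult.commute[of g] X1_g by (rule add_power_R)
  then have 1: "g ^ p * X1 ^ p = (f ^ p) ^ (l * t + 1) + (r ^ p) ^ t"
    by (simp only: power_mult_distrib power_mult[symmetric] mult.commute)
  have "(f ^ l * X2) ^ p = (r - X1 ^ m) ^ p" by (simp add: r_eq)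
  then have 2: "(f ^ p) ^ l * X2 ^ p = r ^ p - (X1 ^ p) ^ m"
    unfolding diff_power_R by (simp only: power_mult_distrib power_mult[symmetric] mult.commute)
  have "(f + X2 ^ t) ^ p = (X1 * X3) ^ p" by (simp add: f_eq)
  then have 3: "X1 ^ p * X3 ^ p = f ^ p + (X2 ^ p) ^ t"
    unfolding add_power_R by (simp only: power_mult_distrib power_mult[symmetric] mult.commute)
  have "emb g ^ p * poly (V X1) (emb r ^ p) = emb g ^ p * emb (X1 ^ p)"
    using arg_cong[OF V_eqs(1), of "\<lambda>P. poly P (emb r ^ p)"] arg_cong[OF 1, of emb]
    by (simp add: Uh_simps E)
  then have x: "poly (V X1) (emb r ^ p) = emb (X1 ^ p)" using g_nonzero by simp
  have "(emb f ^ p) ^ l * poly (V X2) (emb r ^ p) = (emb f ^ p) ^ l * emb (X2 ^ p)"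
    using arg_cong[OF V_eqs(2), of "\<lambda>P. poly P (emb r ^ p)"] arg_cong[OF 2, of emb] x
    by (simp add: Uh_simps E)
  then have y: "poly (V X2) (emb r ^ p) = emb (X2 ^ p)" using f_nonzero by simp
  have "V (X1 * X3 - X2 ^ t) = [:emb f ^ p:]"
    using V_fgr(1) unfolding f_eq[symmetric] .
  from arg_cong[OF this, of "\<lambda>P. poly P (emb r ^ p)"]
  have "emb (X1 ^ p) * poly (V X3) (emb r ^ p) = emb f ^ p + emb (X2 ^ p) ^ t"
    by (simp add: rhom.hom[OF rhom_Uh] x y diff_eq_eq)
  also have "\<dots> = emb (X1 ^ p) * emb (X3 ^ p)"
    by (simp only: E[symmetric] 3)
  finally have z: "poly (V X3) (emb r ^ p) = emb (X3 ^ p)"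
    using prime_elem_X1 by (simp add: E X1_def)
  show ?thesis
    by (rule R3_hom_eqI[OF rhom_comp[OF rhom_poly rhom_Uh] rhom_comp[OF rhom_emb rhom_ev3[OF rhom_cR]]])
      (simp_all only: x y z ev3_simps[OF rhom_cR], simp add: Uh_simps cK_def)
qed

text \<open>Where \<open>f * g\<close> vanishes, \<open>xP\<close> and \<open>yP\<close> reduce to
  \<open>p\<close>-th powers of the variables, and so does \<open>zP\<close>; thus both sides agree
  on generators.\<close>

lemma hom_Phi_theta:
  assumes \<phi>: "rhom \<phi>" and 0: "\<phi> (f * g) = 0" "\<phi> X1 \<noteq> 0" and c: "\<And>c. \<phi> (cR c) = iT c"
    and \<theta>: "theta p (\<phi> X1) = \<phi> X1 ^ p" "theta p (\<phi> X2) = \<phi> X2 ^ p" "theta p (\<phi> X3) = \<phi> X3 ^ p"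
  shows "\<phi> (Phi P) = theta p (\<phi> P)"
proof -
  note H = rhom.hom[OF \<phi>]
  have "xP = X1 ^ p + f * g * (f ^ (l * p) * W)" by (simp add: xP_def mult_ac)
  then have x: "\<phi> xP = \<phi> X1 ^ p" by (simp only: H 0[unfolded H]) simp
  have y: "\<phi> yP = \<phi> X2 ^ p" unfolding yP_def by (simp only: H 0[unfolded H]) simp
  \<comment> \<open>\<open>zP\<close> has no explicit congruence. Its value results from comparing
    \<open>xP_zP\<close> with the \<open>p\<close>-th power of \<open>f + X2 ^ t = X1 * X3\<close>
    and cancelling \<open>\<phi> X1 ^ p\<close>.\<close>
  have "\<phi> X1 ^ p * \<phi> zP = \<phi> (xP * zP)" by (simp only: H x)
  also have "\<dots> = \<phi> (f ^ p + (X2 ^ t) ^ p)"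
    unfolding xP_zP by (simp only: H y power_mult[symmetric] mult.commute)
  also have "f ^ p + (X2 ^ t) ^ p = (X1 * X3) ^ p"
    unfolding add_power_R[symmetric] by (simp add: f_eq)
  also have "\<phi> \<dots> = \<phi> X1 ^ p * \<phi> X3 ^ p" by (simp only: H power_mult_distrib)
  finally have z: "\<phi> zP = \<phi> X3 ^ p" using 0 by simp
  show ?thesis
    by (rule R3_hom_eqI[OF rhom_comp[OF \<phi> rhom_Phi] rhom_comp[OF rhom_theta[OF p_pos] \<phi>]])
      (simp_all only: Phi_simps x y z \<theta> c theta_iT[OF p_pos])
qed

lemma phif_Phi: "phif (Phi P) = theta p (phif P)"
  by (rule hom_Phi_theta[OF rhom_phif])
    (simp_all add: rhom.hom[OF rhom_phif] phif_f phif_simps rhom.hom[OF rhom_theta[OF p_pos]]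
      theta_XT[OF p_pos] theta_WT[OF p_pos] power_mult_distrib power_mult[symmetric] mult.commute)

lemma phig_Phi: "phig (Phi P) = theta p (phig P)"
proof (rule hom_Phi_theta[OF rhom_phig])
  note H = rhom.hom[OF rhom_theta[OF p_pos]] theta_XT[OF p_pos] theta_WT[OF p_pos]
  \<comment> \<open>True for \<open>p = 2\<close> as well, where -1 = 1; it makes the sign in
    \<open>YT\<close> compatible with \<open>p\<close>-th powers.\<close>
  have "(- 1 :: 'a fls poly) ^ p = - 1"
    using minus_power_prime_CHAR[of p "1 :: 'a fls poly"] prime_p CHAR_p by simp
  then have sg: "((- 1 :: 'a fls poly) ^ l) ^ p = (- 1) ^ l"
    by (metis power_mult mult.commute)
  have Y: "theta p YT = YT ^ p"
    unfolding YT_def diff_power_T power_mult_distrib sg by (simp add: H power_mult[symmetric] mult.commute)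
  then show "theta p (phig X2) = phig X2 ^ p" by (simp add: phig_simps)
  have "WT ^ p * theta p ZT = theta p (WT * ZT)" by (simp add: H)
  also have "\<dots> = (YT ^ t - XT (int t)) ^ p"
    unfolding WT_ZT diff_power_T by (simp add: H Y power_mult[symmetric] mult.commute)
  also have "\<dots> = WT ^ p * ZT ^ p" unfolding WT_ZT[symmetric] by (rule power_mult_distrib)
  finally show "theta p (phig X3) = phig X3 ^ p" by (simp add: phig_simps)
qed (simp_all add: rhom.hom[OF rhom_phig] phig_g phig_simps theta_WT[OF p_pos])

section \<open>Expansions in \<open>f ^ i * g ^ j\<close> over the image of
  \<open>Phi\<close>\<close>

definition basis_sum :: "(nat \<Rightarrow> nat \<Rightarrow> 'a R3) \<Rightarrow> 'a R3" where
  "basis_sum P = (\<Sum>i<p. \<Sum>j<p. Phi (P i j) * f ^ i * g ^ j)"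

lemma sum_p_shift: "sum F {..<p} = F 0 + (\<Sum>i<p - 1. F (Suc i))" for F :: "nat \<Rightarrow> 'b::comm_monoid_add"
proof -
  have "{..<p} = {..<Suc (p - 1)}" using p_pos by simp
  then show ?thesis by (simp only: sum.lessThan_Suc_shift)
qed

lemma sum_p_last: "sum F {..<p} = (\<Sum>i<p - 1. F i) + F (p - 1)" for F :: "nat \<Rightarrow> 'b::comm_monoid_add"
proof -
  have "{..<p} = {..<Suc (p - 1)}" using p_pos by simp
  then show ?thesis by (simp only: sum.lessThan_Suc)
qed

lemma sum_p_zero_power: "(\<Sum>i<p. F i * 0 ^ i) = F 0" for F :: "nat \<Rightarrow> 'b::comm_ring_1"
  by (simp add: sum_p_shift)

lemma power_p: "x ^ p = x * x ^ (p - 1)" for x :: "'b::comm_ring_1"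
  using p_pos by (metis power_minus_mult mult.commute)

text \<open>On \<open>f = 0\<close> only row \<open>i = 0\<close> survives and becomes an expansion
  in powers of \<tau>^(mt-1) over the image of \<open>theta p\<close>; \<open>p\<close> does not
  divide mt-1.\<close>

lemma f_dvd_basis_sum:
  assumes "f dvd basis_sum P" "j < p" shows "f dvd P 0 j"
proof -
  have "0 = phif (basis_sum P)" using assms(1) f_dvd_iff by simp
  also have "\<dots> = (\<Sum>i<p. (\<Sum>j<p. theta p (phif (P i j)) * phif g ^ j) * 0 ^ i)"
    unfolding basis_sum_def rhom.hom[OF rhom_phif] phif_f phif_Phi sum_distrib_right by (simp only: mult_ac)
  also have "\<dots> = (\<Sum>j<p. theta p (phif (P 0 j)) * phif g ^ j)"
    by (rule sum_p_zero_power)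
  also have "\<dots> = (\<Sum>j<p. XT (int ((m * t - 1) * j)) * theta p (phif (P 0 j)))"
    by (simp add: phif_g XT_power mult_ac)
  finally have "phif (P 0 j) = 0"
    using theta_independent[OF prime_p p_mt _ assms(2), of "\<lambda>j. phif (P 0 j)"] by simp
  then show ?thesis by (rule phif_kernel)
qed

text \<open>On \<open>g = 0\<close> only column \<open>j = 0\<close> survives, \<open>f\<close>
  becomes -\<tau>^t, and \<open>p\<close> does not divide \<open>t\<close>.\<close>

lemma g_dvd_basis_sum:
  assumes "g dvd basis_sum P" "i < p" shows "g dvd P i 0"
proof -
  have "0 = phig (basis_sum P)" using assms(1) g_dvd_iff by simp
  also have "\<dots> = (\<Sum>i<p. theta p (phig (P i 0)) * phig f ^ i)"
    unfolding basis_sum_def rhom.hom[OF rhom_phig] phig_g phig_Phi sum_p_zero_power ..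
  \<comment> \<open>The sign \<open>(- 1) ^ i\<close> moves into the argument of
    \<open>theta p\<close>, which fixes it.\<close>
  also have "\<dots> = (\<Sum>i<p. XT (int (t * i)) * theta p ((- 1) ^ i * phig (P i 0)))"
    by (intro sum.cong refl, subst phig_f, subst power_minus)
      (simp add: XT_power rhom.hom[OF rhom_theta[OF p_pos]] mult_ac)
  finally have "(- 1) ^ i * phig (P i 0) = 0"
    using theta_independent[OF prime_p p_t _ assms(2), of "\<lambda>i. (- 1) ^ i * phig (P i 0)"] by simp
  then have "phig (P i 0) = 0" by simp
  then show ?thesis by (rule phig_kernel)
qed

lemma basis_sum_cong: "(\<And>i j. i < p \<Longrightarrow> j < p \<Longrightarrow> P i j = Q i j) \<Longrightarrow> basis_sum P = basis_sum Q"
  unfolding basis_sum_def by (intro sum.cong refl) auto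

lemma sum_rotate:
  fixes F G :: "nat \<Rightarrow> 'b::comm_ring_1"
  assumes "\<And>i. i < p - 1 \<Longrightarrow> F (Suc i) = c * G i" "F 0 = c * G (p - 1)"
  shows "sum F {..<p} = c * sum G {..<p}"
  unfolding sum_p_shift[of F] sum_p_last[of G] distrib_left sum_distrib_left
  using assms by (simp add: add.commute)

text \<open>Since \<open>Phi f = f ^ p\<close>, a factor \<open>f\<close> inside row 0 becomes
  \<open>f * f ^ (p - 1)\<close>; taking \<open>f\<close> out of every term rotates the rows, row 0
  moving to the end.\<close>

lemma basis_sum_rotate_f:
  assumes "\<And>j. j < p \<Longrightarrow> P 0 j = f * Q j"
  shows "basis_sum P = f * basis_sum (\<lambda>i j. if Suc i < p then P (Suc i) j else Q j)"
  unfolding basis_sum_def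
proof (rule sum_rotate)
  show "(\<Sum>j<p. Phi (P 0 j) * f ^ 0 * g ^ j) =
      f * (\<Sum>j<p. Phi (if Suc (p - 1) < p then P (Suc (p - 1)) j else Q j) * f ^ (p - 1) * g ^ j)"
    unfolding sum_distrib_left
    by (intro sum.cong refl) (simp add: assms rhom.hom[OF rhom_Phi] Phi_fgr power_p[of f] mult_ac)
  show "(\<Sum>j<p. Phi (P (Suc i) j) * f ^ Suc i * g ^ j) =
      f * (\<Sum>j<p. Phi (if Suc i < p then P (Suc i) j else Q j) * f ^ i * g ^ j)" if "i < p - 1" for i
    using that less_diff_conv[of i p 1] unfolding sum_distrib_left by (intro sum.cong refl) (auto simp: mult_ac)
qed

lemma basis_sum_rotate_g:
  assumes "\<And>i. i < p \<Longrightarrow> P i 0 = g * Q i"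
  shows "basis_sum P = g * basis_sum (\<lambda>i j. if Suc j < p then P i (Suc j) else Q i)"
  unfolding basis_sum_def
proof (subst sum_distrib_left, intro sum.cong refl)
  fix i assume i: "i \<in> {..<p}"
  show "(\<Sum>j<p. Phi (P i j) * f ^ i * g ^ j) =
      g * (\<Sum>j<p. Phi (if Suc j < p then P i (Suc j) else Q i) * f ^ i * g ^ j)"
  proof (rule sum_rotate)
    show "Phi (P i 0) * f ^ i * g ^ 0 =
        g * (Phi (if Suc (p - 1) < p then P i (Suc (p - 1)) else Q i) * f ^ i * g ^ (p - 1))"
      using i by (simp add: assms rhom.hom[OF rhom_Phi] Phi_fgr power_p[of g] mult_ac)
    show "Phi (P i (Suc j)) * f ^ i * g ^ Suc j =
        g * (Phi (if Suc j < p then P i (Suc j) else Q i) * f ^ i * g ^ j)" if "j < p - 1" for j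
      using that less_diff_conv[of j p 1] by (auto simp: mult_ac)
  qed
qed

text \<open>Row 0 is divisible by \<open>f\<close>; taking \<open>f\<close> out keeps the sum zero
  and moves row \<open>Suc i\<close> to row \<open>i\<close>.\<close>

lemma f_dvd_coefficients:
  assumes "basis_sum P = 0" "i < p" "j < p" shows "f dvd P i j"
  using assms
proof (induction i arbitrary: P)
  case 0
  then show ?case using f_dvd_basis_sum[of P j] by simp
next
  case (Suc i)
  define Q where "Q j = P 0 j div f" for j
  have "P 0 j = f * Q j" if "j < p" for j
    using f_dvd_basis_sum[of P j] Suc.prems that by (simp add: Q_def)
  then have "f * basis_sum (\<lambda>i j. if Suc i < p then P (Suc i) j else Q j) = 0"
    using basis_sum_rotate_f[of P Q] Suc.prems by simp
  then have "basis_sum (\<lambda>i j. if Suc i < p then P (Suc i) j else Q j) = 0"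
    using f_nonzero by simp
  from Suc.IH[OF this] show ?case using Suc.prems by simp
qed

text \<open>Infinite descent: all coefficients are divisible by \<open>f\<close>, and dividing them
  by \<open>f\<close> divides the sum by \<open>f ^ p\<close>. The degrees in the outer variable,
  bounded by \<open>n\<close>, drop since \<open>f\<close> has degree 1.\<close>

lemma basis_sum_injective:
  assumes "basis_sum P = 0" "i < p" "j < p" shows "P i j = 0"
proof -
  have "P i j = 0" if "basis_sum P = 0" "i < p" "j < p"
    "\<And>i j. i < p \<Longrightarrow> j < p \<Longrightarrow> P i j \<noteq> 0 \<Longrightarrow> degree (P i j) < n" for n P i j
    using that
  proof (induction n arbitrary: P i j)
    case 0
    then show ?case by blast
  next
    case (Suc n)
    define Q where "Q i j = P i j div f" for i j
    have Q: "P i j = f * Q i j" if "i < p" "j < p" for i j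
      using f_dvd_coefficients[of P i j] Suc.prems(1) that by (simp add: Q_def)
    have "basis_sum P = basis_sum (\<lambda>i j. f * Q i j)" by (rule basis_sum_cong) (rule Q)
    also have "\<dots> = f ^ p * basis_sum Q"
      unfolding basis_sum_def sum_distrib_left by (simp only: rhom.hom[OF rhom_Phi] Phi_fgr mult_ac)
    finally have "basis_sum Q = 0" using Suc.prems(1) f_nonzero by simp
    moreover have "degree (Q i j) < n" if "i < p" "j < p" "Q i j \<noteq> 0" for i j
      using Suc.prems(4)[OF that(1,2)] Q[OF that(1,2)] that(3) f_nonzero
      by (simp add: degree_mult_eq degree_f)
    ultimately have "Q i j = 0" using Suc.IH[of Q i j] Suc.prems(2,3) by blast
    then show ?case using Q[OF Suc.prems(2,3)] by simp
  qed
  moreover have "degree (P i j) < Suc (\<Sum>i<p. \<Sum>j<p. degree (P i j))" if "i < p" "j < p" for i j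
  proof -
    have "degree (P i j) \<le> (\<Sum>j<p. degree (P i j))" using that by (intro member_le_sum) auto
    also have "\<dots> \<le> (\<Sum>i<p. \<Sum>j<p. degree (P i j))" using that by (intro member_le_sum) auto
    finally show ?thesis by simp
  qed
  ultimately show ?thesis using assms by blast
qed

section \<open>Presentation of \<open>range phi5\<close> and cancellation of \<open>f\<close> and
  \<open>g\<close>\<close>

definition phi5 :: "'a R5 \<Rightarrow> 'a R3" where "phi5 = ev5 xP yP zP f g"

lemma rhom_phi5: "rhom phi5"
  unfolding phi5_def by (rule rhom_ev5)

lemma phi5_simps: "phi5 (incl35 u) = Phi u" "phi5 Y5 = f" "phi5 Z5 = g" "phi5 (cR5 c) = cR c"
  unfolding phi5_def Phi_def by (simp_all only: ev5_simps)

lemma phi5_basis_sum: "phi5 (\<Sum>i<p. \<Sum>j<p. incl35 (c i j) * Y5 ^ i * Z5 ^ j) = basis_sum c"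
  by (simp only: rhom.hom[OF rhom_phi5] phi5_simps basis_sum_def)

lemma phi5_relations:
  "phi5 (A * (Y5 ^ p - incl35 f) + B * (Z5 ^ p - incl35 g) + P) = phi5 P"
  by (simp add: rhom.hom[OF rhom_phi5] phi5_simps Phi_fgr)

lemma range_phi5_eq: "range phi5 = range basis_sum"
proof
  show "range phi5 \<subseteq> range basis_sum"
  proof (rule image_subsetI)
    fix P :: "'a R5"
    obtain A B c where "P = A * (Y5 ^ p - incl35 f) + B * (Z5 ^ p - incl35 g) +
      (\<Sum>i<p. \<Sum>j<p. incl35 (c i j) * Y5 ^ i * Z5 ^ j)"
      using R5_normal_form[OF p_pos] by blast
    then show "phi5 P \<in> range basis_sum" by (simp add: phi5_relations phi5_basis_sum)
  qed
  show "range basis_sum \<subseteq> range phi5"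
    by (auto simp: phi5_basis_sum[symmetric])
qed

text \<open>Modulo the relations \<open>P\<close> is in normal form, whose image is a
  \<open>basis_sum\<close>; this vanishes only if all coefficients do.\<close>

lemma phi5_kernel:
  "{P. phi5 P = 0} = {A * (Y5 ^ p - incl35 f) + B * (Z5 ^ p - incl35 g) | A B. True}"
proof
  show "{P. phi5 P = 0} \<subseteq> {A * (Y5 ^ p - incl35 f) + B * (Z5 ^ p - incl35 g) | A B. True}"
  proof
    fix P assume P: "P \<in> {P. phi5 P = 0}"
    obtain A B c where n: "P = A * (Y5 ^ p - incl35 f) + B * (Z5 ^ p - incl35 g) +
      (\<Sum>i<p. \<Sum>j<p. incl35 (c i j) * Y5 ^ i * Z5 ^ j)"
      using R5_normal_form[OF p_pos] by blast
    then have "basis_sum c = 0" using P by (simp add: phi5_relations phi5_basis_sum)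
    then have "c i j = 0" if "i < p" "j < p" for i j using basis_sum_injective that by blast
    then have "P = A * (Y5 ^ p - incl35 f) + B * (Z5 ^ p - incl35 g)"
      unfolding n by (simp add: rhom.zero[OF rhom_incl35])
    then show "P \<in> {A * (Y5 ^ p - incl35 f) + B * (Z5 ^ p - incl35 g) | A B. True}" by blast
  qed
  show "{A * (Y5 ^ p - incl35 f) + B * (Z5 ^ p - incl35 g) | A B. True} \<subseteq> {P. phi5 P = 0}"
    using phi5_relations[of _ _ 0] by (auto simp: rhom.zero[OF rhom_phi5])
qed

text \<open>Divisibility of the expansion by \<open>f\<close> forces that of row 0, and the rotated
  expansion exhibits the quotient.\<close>

lemma range_phi5_cancel_f:
  assumes "f * c \<in> range phi5" shows "c \<in> range phi5"
proof -
  obtain P where P: "f * c = basis_sum P" using assms unfolding range_phi5_eq by auto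
  define Q where "Q j = P 0 j div f" for j
  have "P 0 j = f * Q j" if "j < p" for j
    using f_dvd_basis_sum[of P j] that unfolding P[symmetric] by (simp add: Q_def)
  from basis_sum_rotate_f[of P Q, OF this] have "c = basis_sum (\<lambda>i j. if Suc i < p then P (Suc i) j else Q j)"
    using P f_nonzero by simp
  then show ?thesis unfolding range_phi5_eq by blast
qed

lemma range_phi5_cancel_g:
  assumes "g * c \<in> range phi5" shows "c \<in> range phi5"
proof -
  obtain P where P: "g * c = basis_sum P" using assms unfolding range_phi5_eq by auto
  define Q where "Q i = P i 0 div g" for i
  have "P i 0 = g * Q i" if "i < p" for i
    using g_dvd_basis_sum[of P i] that unfolding P[symmetric] by (simp add: Q_def)
  from basis_sum_rotate_g[of P Q, OF this] have "c = basis_sum (\<lambda>i j. if Suc j < p then P i (Suc j) else Q i)"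
    using P g_nonzero by simp
  then show ?thesis unfolding range_phi5_eq by blast
qed

lemma range_phi5_cancel: "(f * g) ^ N * c \<in> range phi5 \<Longrightarrow> c \<in> range phi5"
  by (induction N) (auto simp: mult.assoc dest!: range_phi5_cancel_f range_phi5_cancel_g)

section \<open>Invariants as polynomials in \<open>q\<close> over \<open>C\<close>\<close>

lemma emb_a0_mem: "emb a\<^sub>0 \<in> C"
proof -
  have "emb h \<in> C" using h_mem ev2_mem_C unfolding range_ev2 by auto
  then show ?thesis by (simp only: rhom.hom[OF rhom_emb] C.mult C.power C_mem)
qed

definition QX :: "'a K3 poly" where
  "QX = [:0, 1:] ^ p - [:emb a\<^sub>0 ^ (p - 1):] * [:0, 1:]"

lemma QX_mem: "QX \<in> polys_over C"
  unfolding QX_def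
  by (intro CX.diff CX.mult CX.power C.X_mem C.const_mem C.power emb_a0_mem)

lemma poly_QX_r: "poly QX (emb r) = emb q"
  unfolding q_eq by (simp add: QX_def rhom.hom[OF rhom_emb])

lemma poly_QX_shift: "poly QX (emb r + emb a\<^sub>0) = emb q"
proof -
  have "(emb r + emb a\<^sub>0) ^ p = emb r ^ p + emb a\<^sub>0 ^ p"
    by (rule freshmans_dream) (simp_all add: prime_p CHAR_K)
  moreover have "emb a\<^sub>0 ^ p = emb a\<^sub>0 ^ (p - 1) * emb a\<^sub>0"
    using p_pos by (metis power_minus_mult)
  ultimately have "poly QX (emb r + emb a\<^sub>0) = poly QX (emb r)"
    by (simp add: QX_def algebra_simps)
  then show ?thesis by (simp only: poly_QX_r)
qed

lemma mem_invariants_iff: "b \<in> invariants l m t h \<longleftrightarrow> poly (U b) (emb r + emb a\<^sub>0) = emb b"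
  by (simp add: invariants_def eps_h_eq)

lemma mem_invariantsI:
  assumes "v \<in> polys_over C" "emb b = poly v (emb q)" shows "b \<in> invariants l m t h"
proof -
  have "U b = pcompose v QX"
    by (rule polys_over_C_eqI[OF U_mem C.pcompose_mem[OF assms(1) QX_mem]])
      (simp add: poly_U_r assms poly_pcompose poly_QX_r)
  then show ?thesis
    by (simp add: mem_invariants_iff poly_pcompose poly_QX_shift assms(2))
qed

text \<open>By transcendence of \<open>r\<close>, invariance of \<open>b\<close> means that
  \<open>U b\<close> equals its translate by \<open>emb a\<^sub>0\<close>, so the Artin-Schreier
  lemma applies over \<open>C\<close>.\<close>

lemma mem_invariantsE:
  assumes "b \<in> invariants l m t h"
  obtains v where "v \<in> polys_over C" "emb b = poly v (emb q)"
proof -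
  have "[:emb a\<^sub>0, 1:] = [:emb a\<^sub>0:] + [:0, 1:]" by simp
  also have "\<dots> \<in> polys_over C" by (intro CX.add C.const_mem C.X_mem emb_a0_mem)
  finally have m: "pcompose (U b) [:emb a\<^sub>0, 1:] \<in> polys_over C"
    by (rule C.pcompose_mem[OF U_mem])
  have "pcompose (U b) [:emb a\<^sub>0, 1:] = U b"
    by (rule polys_over_C_eqI[OF m U_mem])
      (use assms in \<open>simp add: poly_pcompose mem_invariants_iff poly_U_r add.commute\<close>)
  moreover have "emb a\<^sub>0 \<noteq> 0" using a0_nonzero by simp
  ultimately obtain v where v: "v \<in> polys_over C" "U b = pcompose v QX"
    using artin_schreier_invariant[OF is_subring_C prime_p CHAR_K emb_a0_mem _ U_mem] 
    unfolding QX_def by blast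
  have "emb b = poly (pcompose v QX) (emb r)" by (simp only: poly_U_r v(2)[symmetric])
  then have "emb b = poly v (emb q)" by (simp add: poly_pcompose poly_QX_r)
  with v(1) show ?thesis by (rule that)
qed

text \<open>One polynomial over \<open>C\<close> whose value at \<open>r ^ p\<close> is an element
  of k[x1^p,x2^p,x3^p,f,g] and whose value at \<open>q\<close> is the image under
  \<open>psi\<close>.\<close>

definition V5 :: "'a R5 \<Rightarrow> 'a K3 poly" where
  "V5 = ext (ext V [:emb f:]) [:emb g:]"

lemma V5_mem: "V5 P \<in> polys_over C"
  unfolding V5_def by (intro CX.ext_mem rhom_ext rhom_Uh V_mem C.const_mem C_mem)

lemma rhom_V5: "rhom V5"
  unfolding V5_def by (intro rhom_ext rhom_Uh)

lemma R5_hom_eqI: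
  assumes "rhom \<phi>" "rhom \<psi>" "\<And>u. \<phi> (incl35 u) = \<psi> (incl35 u)" "\<phi> Y5 = \<psi> Y5" "\<phi> Z5 = \<psi> Z5"
  shows "\<phi> P = \<psi> (P :: 'a R5)"
proof -
  have "\<phi> [:c:] = \<psi> [:c:]" for c
    by (rule poly_hom_eqI[of "\<lambda>c. \<phi> [:c:]" "\<lambda>c. \<psi> [:c:]", OF rhom_comp[OF assms(1) rhom_pC]
          rhom_comp[OF assms(2) rhom_pC]]) (use assms in \<open>simp_all add: incl35_def Y5_def\<close>)
  then show ?thesis
    by (rule poly_hom_eqI[OF assms(1,2)]) (use assms(5) in \<open>simp_all add: Z5_def\<close>)
qed

lemma V5_simps: "V5 (incl35 u) = V u" "V5 Y5 = [:emb f:]" "V5 Z5 = [:emb g:]"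
  by (simp_all add: V5_def incl35_def Y5_def Z5_def ext_const ext_X rhom_ext rhom_Uh)

lemma poly_V5_q: "poly (V5 P) (emb q) = emb (phi5 P)"
  by (rule R5_hom_eqI[OF rhom_comp[OF rhom_poly rhom_V5] rhom_comp[OF rhom_emb rhom_phi5]])
    (simp_all add: V5_simps phi5_simps poly_V_q)

lemma poly_V5_r: "poly (V5 P) (emb r ^ p) = emb (ev5 (X1 ^ p) (X2 ^ p) (X3 ^ p) f g P)"
  by (rule R5_hom_eqI[OF rhom_comp[OF rhom_poly rhom_V5] rhom_comp[OF rhom_emb rhom_ev5]])
    (simp_all add: V5_simps ev5_simps poly_V_r)

lemma psi_ev5: "psi p l m t h (emb (ev5 (X1 ^ p) (X2 ^ p) (X3 ^ p) f g P)) = emb (phi5 P)"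
  using psi_eq[OF V5_mem p_pos, of h P] by (simp only: poly_V5_r poly_V5_q)

text \<open>An invariant times a power of \<open>f * g\<close> is a polynomial in \<open>f\<close>,
  \<open>g\<close>, \<open>q\<close>, which lie in \<open>range phi5\<close> as
  \<open>q = Phi r\<close>; the power then cancels.\<close>

lemma invariants_eq: "invariants l m t h = range phi5"
proof
  show "range phi5 \<subseteq> invariants l m t h"
    by (intro image_subsetI mem_invariantsI[OF V5_mem]) (rule poly_V5_q[symmetric])
  interpret B: is_subring "range phi5" by (rule is_subring_range[OF rhom_phi5])
  have mem: "cR c \<in> range phi5" "f \<in> range phi5" "g \<in> range phi5" "q \<in> range phi5" for c
    using rangeI[of phi5 "cR5 c"] rangeI[of phi5 Y5] rangeI[of phi5 Z5] rangeI[of phi5 "incl35 r"]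
    by (simp_all only: phi5_simps Phi_fgr)
  show "invariants l m t h \<subseteq> range phi5"
  proof
    fix b assume "b \<in> invariants l m t h"
    then obtain v where v: "v \<in> polys_over C" "emb b = poly v (emb q)" by (rule mem_invariantsE)
    obtain N P where P: "smult (emb (f * g) ^ N) v = map_poly (\<lambda>c. emb (ev2 c)) P"
      using clear_denominators[OF v(1)] by blast
    have EE: "rhom (\<lambda>c. emb (ev2 c))" by (rule rhom_comp[OF rhom_emb rhom_ev2])
    have "emb (ext ev2 q P) = ext (\<lambda>c. emb (ev2 c)) (emb q) P"
      by (rule poly_hom_eqI[OF rhom_comp[OF rhom_emb rhom_ext[OF rhom_ev2]] rhom_ext[OF EE]])
        (simp_all add: ext_const ext_X EE rhom_ev2)
    also have "\<dots> = emb ((f * g) ^ N * b)"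
      unfolding ext_def P[symmetric] by (simp add: v(2) rhom.hom[OF rhom_emb])
    finally have "(f * g) ^ N * b = ext ev2 q P" by simp
    also have "\<dots> \<in> range phi5"
      unfolding ev2_def by (intro B.ext_mem rhom_ext rhom_cR mem)
    finally show "b \<in> range phi5" by (rule range_phi5_cancel)
  qed
qed

end

section \<open>Tangent vectors at the origin\<close>

text \<open>Gaussian elimination of the last unknown.\<close>

lemma homogeneous_solution:
  fixes a :: "nat \<Rightarrow> nat \<Rightarrow> 'k::field"
  shows "\<exists>c. (\<exists>j\<le>n. c j \<noteq> 0) \<and> (\<forall>i<n. (\<Sum>j\<le>n. a i j * c j) = 0)"
proof (induction n arbitrary: a)
  case 0
  show ?case by (rule exI[of _ "\<lambda>_. 1"]) auto
next
  case (Suc n)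
  show ?case
  proof (cases "\<forall>i\<le>n. a i (Suc n) = 0")
    case True
    then show ?thesis
      by (intro exI[of _ "\<lambda>j. if j = Suc n then 1 else 0"])
        (use True in \<open>auto simp: less_Suc_eq_le\<close>)
  next
    case False
    then obtain k where k: "k \<le> n" "a k (Suc n) \<noteq> 0" by blast
    \<comment> \<open>\<open>\<sigma>\<close> enumerates the rows other than the pivot row
      \<open>k\<close>.\<close>
    define \<sigma> where "\<sigma> i = (if i < k then i else Suc i)" for i :: nat
    define b where "b i j = a (\<sigma> i) j - a (\<sigma> i) (Suc n) / a k (Suc n) * a k j" for i j
    obtain c where c: "\<exists>j\<le>n. c j \<noteq> 0" "\<And>i. i < n \<Longrightarrow> (\<Sum>j\<le>n. b i j * c j) = 0"
      using Suc.IH[of b] by blast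
    define S where "S = (\<Sum>j\<le>n. a k j * c j)"
    define c' where "c' j = (if j = Suc n then - S / a k (Suc n) else c j)" for j
    have sum': "(\<Sum>j\<le>Suc n. a i j * c' j) = (\<Sum>j\<le>n. a i j * c j) - a i (Suc n) / a k (Suc n) * S" for i
      by (simp add: c'_def)
    have "(\<Sum>j\<le>Suc n. a i j * c' j) = 0" if i: "i < Suc n" for i
    proof (cases "i = k")
      case True
      then show ?thesis using k unfolding sum' by (simp add: S_def)
    next
      case False
      obtain i' where i': "i' < n" "\<sigma> i' = i"
      proof (cases "i < k")
        case True
        then show ?thesis using that[of i] k by (simp add: \<sigma>_def)
      next
        case False
        then show ?thesis using that[of "i - 1"] \<open>i \<noteq> k\<close> i by (auto simp: \<sigma>_def)
      qed
      have "(\<Sum>j\<le>n. b i' j * c j) = (\<Sum>j\<le>n. a i j * c j) - a i (Suc n) / a k (Suc n) * S"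
        by (simp add: b_def i' S_def left_diff_distrib sum_subtractf sum_distrib_left mult.assoc)
      then show ?thesis unfolding sum' using c(2)[OF i'(1)] by simp
    qed
    moreover have "\<exists>j\<le>Suc n. c' j \<noteq> 0"
    proof -
      obtain j where "j \<le> n" "c j \<noteq> 0" using c(1) by blast
      then show ?thesis by (intro exI[of _ j]) (auto simp: c'_def)
    qed
    ultimately show ?thesis by blast
  qed
qed

text \<open>As a function of the polynomial, the linear coefficient of its restriction to the line spanned by
  \<open>(c 0, c 1, c 2, c 3, 0)\<close> is a tangent vector at the origin.\<close>

definition line :: "(nat \<Rightarrow> 'k) \<Rightarrow> 'k::field R5 \<Rightarrow> 'k poly" where
  "line c = ext (ext (ev3 (\<lambda>k. [:k:]) [:0, c 0:] [:0, c 1:] [:0, c 2:]) [:0, c 3:]) 0"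

lemma rhom_line: "rhom (line c)"
  unfolding line_def by (intro rhom_ext rhom_ev3 rhom_pC)

lemma line_simps:
  "line c (incl35 X1) = [:0, c 0:]" "line c (incl35 X2) = [:0, c 1:]" "line c (incl35 X3) = [:0, c 2:]"
  "line c (incl35 (cR k)) = [:k:]" "line c Y5 = [:0, c 3:]" "line c Z5 = 0"
  by (simp_all add: line_def incl35_def Y5_def Z5_def ext_const ext_X rhom_ext rhom_ev3 rhom_pC ev3_simps)

lemma coeff_mult_1: "coeff (u * v) 1 = coeff u 0 * coeff v 1 + coeff u 1 * coeff v 0" for u v :: "'a::comm_ring_1 poly"
  by (simp add: coeff_mult)

text \<open>The coefficients \<open>a\<close> are independent of \<open>c\<close>, so vanishing
  becomes a linear condition on \<open>c\<close>. The constant term is carried along for the product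
  rule.\<close>

definition has_linear_part :: "'k::field R5 \<Rightarrow> bool" where
  "has_linear_part P \<longleftrightarrow> (\<exists>a0. \<exists>a :: nat \<Rightarrow> 'k. \<forall>c. coeff (line c P) 0 = a0 \<and>
    coeff (line c P) 1 = a 0 * c 0 + a 1 * c 1 + a 2 * c 2 + a 3 * c 3)"

lemma has_linear_partI:
  fixes a :: "nat \<Rightarrow> 'k::field"
  assumes "\<And>c. coeff (line c P) 0 = a0"
    "\<And>c. coeff (line c P) 1 = a 0 * c 0 + a 1 * c 1 + a 2 * c 2 + a 3 * c 3"
  shows "has_linear_part P"
  unfolding has_linear_part_def using assms by blast

lemma has_linear_part_add:
  assumes "has_linear_part P" "has_linear_part Q" shows "has_linear_part (P + Q)"
proof -
  obtain a0 b0 and a b :: "nat \<Rightarrow> _" where ab: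
    "\<And>c. coeff (line c P) 0 = a0" "\<And>c. coeff (line c P) 1 = a 0 * c 0 + a 1 * c 1 + a 2 * c 2 + a 3 * c 3"
    "\<And>c. coeff (line c Q) 0 = b0" "\<And>c. coeff (line c Q) 1 = b 0 * c 0 + b 1 * c 1 + b 2 * c 2 + b 3 * c 3"
    using assms unfolding has_linear_part_def by blast
  show ?thesis
    by (rule has_linear_partI[of _ "a0 + b0" "\<lambda>j. a j + b j"])
      (simp_all only: rhom.add[OF rhom_line] coeff_add ab algebra_simps)
qed

lemma has_linear_part_mult:
  assumes "has_linear_part P" "has_linear_part Q" shows "has_linear_part (P * Q)"
proof -
  obtain a0 b0 and a b :: "nat \<Rightarrow> _" where ab:
    "\<And>c. coeff (line c P) 0 = a0" "\<And>c. coeff (line c P) 1 = a 0 * c 0 + a 1 * c 1 + a 2 * c 2 + a 3 * c 3"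
    "\<And>c. coeff (line c Q) 0 = b0" "\<And>c. coeff (line c Q) 1 = b 0 * c 0 + b 1 * c 1 + b 2 * c 2 + b 3 * c 3"
    using assms unfolding has_linear_part_def by blast
  show ?thesis
    by (rule has_linear_partI[of _ "a0 * b0" "\<lambda>j. a0 * b j + b0 * a j"])
      (simp_all only: rhom.mult[OF rhom_line] coeff_mult_0 coeff_mult_1 ab algebra_simps)
qed

lemma linear_part: "has_linear_part P"
proof -
  note add = has_linear_part_add and mult = has_linear_part_mult
  have incl: "has_linear_part (incl35 u)" for u :: "'a R3"
  proof (induction u rule: R3_induct)
    case (const k)
    show ?case by (rule has_linear_partI[of _ k "\<lambda>_. 0"]) (simp_all add: line_simps)
  next
    case X1
    show ?case by (rule has_linear_partI[of _ 0 "\<lambda>j. if j = 0 then 1 else 0"]) (simp_all add: line_simps)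
  next
    case X2
    show ?case by (rule has_linear_partI[of _ 0 "\<lambda>j. if j = 1 then 1 else 0"]) (simp_all add: line_simps)
  next
    case X3
    show ?case by (rule has_linear_partI[of _ 0 "\<lambda>j. if j = 2 then 1 else 0"]) (simp_all add: line_simps)
  next
    case (add a b)
    then show ?case using has_linear_part_add[of "incl35 a" "incl35 b"] by (simp add: rhom.add[OF rhom_incl35])
  next
    case (mult a b)
    then show ?case using has_linear_part_mult[of "incl35 a" "incl35 b"] by (simp add: rhom.mult[OF rhom_incl35])
  qed
  have Y: "has_linear_part (Y5 :: 'a R5)"
    by (rule has_linear_partI[of _ 0 "\<lambda>j. if j = 3 then 1 else 0"]) (simp_all add: line_simps)
  have Z: "has_linear_part (Z5 :: 'a R5)"
    by (rule has_linear_partI[of _ 0 "\<lambda>j. 0"]) (simp_all add: line_simps)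
  have inner: "has_linear_part [:u:]" for u :: "'a R3 poly"
  proof (induction u rule: poly_ring_induct)
    case (1 c) then show ?case using incl[of c] by (simp add: incl35_def)
  next
    case 2 then show ?case using Y by (simp add: Y5_def)
  next
    case (3 a b) then show ?case using add[of "[:a:]" "[:b:]"] by simp
  next
    case (4 a b) then show ?case using mult[of "[:a:]" "[:b:]"] by (simp add: mult.commute)
  qed
  show ?thesis
  proof (induction P rule: poly_ring_induct)
    case 2 then show ?case using Z by (simp add: Z5_def)
  qed (use inner add mult in blast)+
qed

section \<open>Comparison of tangent spaces\<close>

context invariant_data
begin

text \<open>The \<open>p\<close>-th powers, \<open>f\<close> and \<open>g\<close> all vanish to
  order at least 2 at the origin: \<open>f\<close> because \<open>t\<close> is at least 2,
  \<open>g\<close> by \<open>g_eq\<close>.\<close>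

lemma line_relation:
  "[:0, 0, 1:] dvd line c (Y5 ^ p - incl35 f)" "[:0, 0, 1:] dvd line c (Z5 ^ p - incl35 g)"
proof -
  note H = rhom.hom[OF rhom_line] rhom.hom[OF rhom_incl35] line_simps
  define x where "x = [:0, 1 :: 'a:]"
  have x2: "[:0, 0, 1:] = x ^ 2" by (simp add: x_def power2_eq_square)
  have lin: "[:0, a:] = x * [:a:]" for a by (simp add: x_def)
  have pow: "x ^ 2 dvd (x * u) ^ n" if "n \<ge> 2" for u n
    using that by (simp add: power_mult_distrib le_imp_power_dvd)
  have f1: "line c (incl35 f) = x ^ 2 * [:c 0 * c 2:] - (x * [:c 1:]) ^ t"
    unfolding f_eq by (simp only: H lin) (simp add: power2_eq_square x_def)
  have f: "x ^ 2 dvd line c (incl35 f)"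
    unfolding f1 by (rule dvd_diff[OF dvd_triv_left pow[OF t]])
  show "[:0, 0, 1:] dvd line c (Y5 ^ p - incl35 f)"
    unfolding x2 rhom.diff[OF rhom_line] using f p2
    by (intro dvd_diff) (simp_all only: H lin pow)
  have fl: "x ^ 2 dvd line c (incl35 f) ^ n" if "n \<ge> 1" for n
    using dvd_trans[OF f dvd_power[of n "line c (incl35 f)"]] that by simp
  have S: "x ^ 2 dvd line c (incl35 (X1 ^ (m - 1) * Spol))"
  proof -
    obtain v where v: "line c (incl35 r) = x * v"
    proof -
      have "x dvd line c (incl35 f) ^ l * [:0, c 1:] + [:0, c 0:] ^ m"
      proof (rule dvd_add)
        show "x dvd line c (incl35 f) ^ l * [:0, c 1:]"
          unfolding lin by (intro dvd_mult dvd_triv_left)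
        have "[:0, c 0:] dvd [:0, c 0:] ^ m" using m by (intro dvd_power) simp
        then show "x dvd [:0, c 0:] ^ m"
          unfolding lin by (rule dvd_mult_left)
      qed
      then show ?thesis using that unfolding r_eq by (auto simp: H dvd_def)
    qed
    have fy: "x ^ 2 dvd line c (incl35 (f ^ l * X2))"
      using fl[OF l] by (simp only: H dvd_mult2)
    have s: "x ^ 2 dvd line c (incl35 (X1 ^ (m - 1) * ((f ^ l * X2) ^ (t - Suc i) * r ^ i)))" if i: "i < t" for i
    proof (cases "Suc i = t")
      case True
      \<comment> \<open>Here no factor \<open>f ^ l * X2\<close> remains and the order comes from
        \<open>X1 ^ (m - 1) * r ^ (t - 1)\<close>. The bound would fail only for
        \<open>m = 1\<close>, \<open>t = 2\<close>, excluded by \<open>mt\<close>.\<close>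
      have "m - 1 + (t - 1) \<ge> 2"
        using mt m t by (cases m) (auto simp: nat_neq_iff, cases "m - 1", auto)
      have "line c (incl35 (X1 ^ (m - 1) * ((f ^ l * X2) ^ (t - Suc i) * r ^ i))) =
          x ^ (m - 1 + (t - 1)) * ([:c 0:] ^ (m - 1) * v ^ (t - 1))"
        using True by (auto simp only: H v lin power_mult_distrib power_add) (simp add: mult_ac)
      then show ?thesis using \<open>m - 1 + (t - 1) \<ge> 2\<close> by (metis dvd_mult2 le_imp_power_dvd)
    next
      case False
      then have "line c (incl35 (f ^ l * X2)) dvd line c (incl35 (f ^ l * X2)) ^ (t - Suc i)"
        using i by (intro dvd_power) auto
      from dvd_trans[OF fy this] show ?thesis
        by (simp only: rhom.mult[OF rhom_line] rhom.mult[OF rhom_incl35] rhom.power[OF rhom_line]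
          rhom.power[OF rhom_incl35] dvd_mult dvd_mult2)
    qed
    show ?thesis
      unfolding Spol_def sum_distrib_left rhom.sum[OF rhom_incl35] rhom.sum[OF rhom_line]
      by (intro dvd_sum s) simp
  qed
  have "l * t \<ge> 1" using l t by simp
  from fl[OF this] have "x ^ 2 dvd line c (incl35 (f ^ (l * t) * X3))"
    by (simp only: H dvd_mult2)
  with S have "x ^ 2 dvd line c (incl35 g)"
    unfolding g_eq rhom.add[OF rhom_incl35] rhom.add[OF rhom_line] by (intro dvd_add)
  then show "[:0, 0, 1:] dvd line c (Z5 ^ p - incl35 g)"
    unfolding x2 using p2 by (simp add: rhom.hom[OF rhom_line] line_simps power_0_left)
qed

text \<open>The linear coefficient therefore depends only on \<open>phi5 P\<close>: \<open>c\<close>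
  gives a tangent vector of the ring of invariants.\<close>

lemma line_kernel:
  assumes "phi5 P = 0" shows "coeff (line c P) 1 = 0"
proof -
  obtain A B where P: "P = A * (Y5 ^ p - incl35 f) + B * (Z5 ^ p - incl35 g)"
    using assms phi5_kernel by blast
  have "[:0, 0, 1:] dvd line c P"
    unfolding P rhom.add[OF rhom_line] rhom.mult[OF rhom_line]
    by (intro dvd_add dvd_mult line_relation)
  then show ?thesis by (auto simp: dvd_def)
qed

text \<open>An isomorphism would generate the invariants by three elements. Their lifts impose three
  linear conditions on the four entries of \<open>c\<close>, so a nonzero \<open>c\<close> kills
  them and, by the product rule, everything; but it does not kill all of x1, x2, x3, y.\<close>

lemma not_isomorphic:
  "\<not> (\<exists>\<phi> :: 'a R3 \<Rightarrow> 'a R3. kalg_hom cR cR \<phi> \<and> bij_betw \<phi> UNIV (invariants l m t h))"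
proof
  assume "\<exists>\<phi> :: 'a R3 \<Rightarrow> 'a R3. kalg_hom cR cR \<phi> \<and> bij_betw \<phi> UNIV (invariants l m t h)"
  then obtain \<phi> :: "'a R3 \<Rightarrow> 'a R3" where k: "kalg_hom cR cR \<phi>" and b: "\<phi> ` UNIV = range phi5"
    unfolding invariants_eq bij_betw_def by blast
  have \<phi>: "rhom \<phi>"
  proof
    show "\<phi> 1 = 1"
      using k rhom.one[OF rhom_cR] unfolding kalg_hom_def by metis
  qed (use k in \<open>auto simp: kalg_hom_def\<close>)
  define w where "w u = (SOME w. phi5 w = \<phi> u)" for u
  have w: "phi5 (w u) = \<phi> u" for u
  proof -
    have "\<phi> u \<in> range phi5" using b by blast
    then have "\<exists>w. phi5 w = \<phi> u" by auto
    then show ?thesis unfolding w_def by (rule someI_ex)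
  qed
  define L where "L i = (if i = 0 then w X1 else if i = 1 then w X2 else w X3)" for i :: nat
  have "\<exists>a :: nat \<Rightarrow> 'a. \<forall>c. coeff (line c (L i)) 1 = a 0 * c 0 + a 1 * c 1 + a 2 * c 2 + a 3 * c 3" for i
    using linear_part[of "L i"] unfolding has_linear_part_def by blast
  then obtain a :: "nat \<Rightarrow> nat \<Rightarrow> 'a" where a: "\<forall>c. coeff (line c (L i)) 1 = a i 0 * c 0 + a i 1 * c 1 + a i 2 * c 2 + a i 3 * c 3" for i
    by metis
  have sum3: "(\<Sum>j\<le>3. F j) = F 0 + F 1 + F 2 + F 3" for F :: "nat \<Rightarrow> 'a"
    by (simp add: numeral_3_eq_3 numeral_2_eq_2)
  obtain c where c: "\<exists>j\<le>3. c j \<noteq> 0" "\<forall>i<3. (\<Sum>j\<le>3. a i j * c j) = 0"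
    using homogeneous_solution[of 3 a] by blast
  then have "coeff (line c (L i)) 1 = 0" if "i < 3" for i
    using a[of i] that unfolding sum3 by simp
  from this[of 0] this[of 1] this[of 2]
  have L: "coeff (line c (w X1)) 1 = 0" "coeff (line c (w X2)) 1 = 0" "coeff (line c (w X3)) 1 = 0"
    by (simp_all add: L_def)
  define N where "N = ev3 cR5 (w X1) (w X2) (w X3)"
  have cR5: "rhom cR5" unfolding cR5_def[abs_def] by (rule rhom_comp[OF rhom_incl35 rhom_cR])
  have N: "rhom N" unfolding N_def by (rule rhom_ev3[OF cR5])
  have phiN: "phi5 (N u) = \<phi> u" for u
    by (rule R3_hom_eqI[OF rhom_comp[OF rhom_phi5 N] \<phi>])
      (use k in \<open>simp_all add: N_def ev3_simps[OF cR5] phi5_simps w kalg_hom_def\<close>)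
  have lin0: "coeff (line c (N u)) 1 = 0" for u
  proof (induction u rule: R3_induct)
    case (const k)
    show ?case by (simp add: N_def ev3_simps[OF cR5] cR5_def line_simps)
  next
    case X1
    show ?case using L(1) by (simp only: N_def ev3_simps[OF cR5])
  next
    case X2
    show ?case using L(2) by (simp only: N_def ev3_simps[OF cR5])
  next
    case X3
    show ?case using L(3) by (simp only: N_def ev3_simps[OF cR5])
  next
    case (add x y)
    then show ?case by (simp only: rhom.add[OF N] rhom.add[OF rhom_line] coeff_add add_0_left)
  next
    case (mult x y)
    then show ?case by (simp only: rhom.mult[OF N] rhom.mult[OF rhom_line] coeff_mult_1 mult_zero_left mult_zero_right add_0_left)
  qed
  \<comment> \<open>\<open>N\<close> lifts \<open>\<phi>\<close>, so \<open>P\<close> differs from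
    some \<open>N u\<close> by an element of the kernel of \<open>phi5\<close>.\<close>
  have zero: "coeff (line c P) 1 = 0" for P
  proof -
    have "phi5 P \<in> range \<phi>" using b by simp
    then obtain u where u: "phi5 P = \<phi> u" by (elim rangeE)
    then have "phi5 (P - N u) = 0" by (simp add: rhom.hom[OF rhom_phi5] phiN)
    then have "coeff (line c (P - N u)) 1 = 0" by (rule line_kernel)
    then show ?thesis using lin0[of u] by (simp add: rhom.hom[OF rhom_line])
  qed
  have "c 0 = 0" "c 1 = 0" "c 2 = 0" "c 3 = 0"
    using zero[of "incl35 X1"] zero[of "incl35 X2"] zero[of "incl35 X3"] zero[of Y5]
    by (simp_all add: line_simps)
  then have "c j = 0" if "j \<le> 3" for j using that by (auto simp: le_Suc_eq numeral_3_eq_3 numeral_2_eq_2)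
  then show False using c(1) by blast
qed

end

theorem theorem5p4:
  fixes h :: "'k::field R3" and p l m t :: nat
  assumes "CHAR('k) = p" and "p > 0"
    and "l \<ge> 1" and "m \<ge> 1" and "t \<ge> 2" and "m * t \<ge> 3"
    and "\<not> p dvd t" and "\<not> p dvd (m * t - 1)"
    and "h \<in> kalg cR {fpol t, gpol l m t}"
    and "\<exists>a \<in> kalg cR {fpol t, gpol l m t}. h ^ (p - 1) = fpol t ^ (l + 1) * gpol l m t ^ 2 * a"
    and "h ^ (p - 1) \<noteq> 0"
  shows
    "emb ` invariants l m t h
       = psi p l m t h ` emb ` kalg cR {X1 ^ p, X2 ^ p, X3 ^ p, fpol t, gpol l m t}
     \<and> emb ` invariants l m t h
       = kalg cK {psi p l m t h (emb (X1 ^ p)), psi p l m t h (emb (X2 ^ p)),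
                  psi p l m t h (emb (X3 ^ p)), emb (fpol t), emb (gpol l m t)}
     \<and> (\<exists>phi :: 'k R5 \<Rightarrow> 'k R3.
          kalg_hom cR5 cR phi \<and> phi ` UNIV = invariants l m t h \<and>
          {P. phi P = 0} = {A * (Y5 ^ p - incl35 (fpol t)) + B * (Z5 ^ p - incl35 (gpol l m t)) | A B. True})
     \<and> \<not> (\<exists>phi :: 'k R3 \<Rightarrow> 'k R3.
          kalg_hom cR cR phi \<and> bij_betw phi UNIV (invariants l m t h))"
proof -
  interpret invariant_data l m t "fpol t" "gpol l m t" "rpol l m t" p h
    by unfold_locales (use assms in auto)
  let ?f = "fpol t :: 'k R3" and ?g = "gpol l m t :: 'k R3"
  have psi_X: "psi p l m t h (emb (X1 ^ p)) = emb xP" "psi p l m t h (emb (X2 ^ p)) = emb yP"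
    "psi p l m t h (emb (X3 ^ p)) = emb zP"
    using psi_ev5[of "incl35 X1"] psi_ev5[of "incl35 X2"] psi_ev5[of "incl35 X3"]
    by (simp_all only: ev5_simps ev3_simps[OF rhom_cR] phi5_simps Phi_simps)
  have 1: "emb ` invariants l m t h = psi p l m t h ` emb ` kalg cR {X1 ^ p, X2 ^ p, X3 ^ p, ?f, ?g}"
    unfolding range_ev5[symmetric] image_image psi_ev5 invariants_eq ..
  have 2: "emb ` invariants l m t h = kalg cK {psi p l m t h (emb (X1 ^ p)), psi p l m t h (emb (X2 ^ p)),
      psi p l m t h (emb (X3 ^ p)), emb ?f, emb ?g}"
  proof -
    have "emb ` kalg cR {xP, yP, zP, ?f, ?g} = kalg cK (emb ` {xP, yP, zP, ?f, ?g})"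
      by (rule kalg_image[OF rhom_emb, symmetric]) (simp add: cK_def)
    then show ?thesis
      unfolding psi_X invariants_eq phi5_def range_ev5 by simp
  qed
  have 3: "kalg_hom cR5 cR phi5"
    by (simp add: kalg_hom_def phi5_simps rhom.hom[OF rhom_phi5])
  show ?thesis
    using 1 2 3 invariants_eq phi5_kernel not_isomorphic by blast
qed

end
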